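(* Let $S$ be a finite virtual flat biquandle, $A$ an abelian group without 2-torsion, and $\phi:S\times S\to A$ a map that is a 2-cocycle both of the complex $\mathrm{Hom}(C^{VF}_\ast(S),A)$ and of the complex $\mathrm{Hom}(C^{SF}_\ast(S),A)$; explicitly, for all $a,b,c\in S$: (1) $\phi(a,b)+\phi(b\circ a,a\ast b)=0$; (2) $-\phi(b,c)+\phi(b\circ a,c\circ a)+\phi(a\ast b,c)-\phi(a,c\circ b)-\phi(a\ast c,b\ast c)+\phi(a,b)=0$; (3) $-\phi(b,c)+\phi(b,c\circ a)+\phi(a,c)-\phi(a,c\circ b)=0$. Then for an oriented flat virtual link diagram $L$ the state-sum $\Phi_\phi(L)\in\mathbb{Z}[A]$ is invariant under flat Reidemeister moves, hence is an invariant of the flat virtual link represented by $L$.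
   Context: A virtual flat biquandle is a set $S$ with two binary operations $a\ast b$, $a\circ b$; writing $S_b(a)=a\ast b$, $T_b(a)=a\circ b$, for all $a,b$: $S_aS_b=S_bS_a$, $T_aT_b=T_bT_a$, $S_aT_b=T_bS_a$; $S_a=S_{T_b(a)}=S_{S_b(a)}$, $T_a=T_{S_b(a)}=T_{T_b(a)}$; $T_aS_a=S_aT_a=\mathrm{id}$. Complexes: $C_n(S)$ is free abelian on $n$-tuples of elements of $S$. $C^{VF}_\ast(S)=C_\ast(S)/C'_\ast(S)$ with boundary $\partial_n(a_1,\dots,a_n)=\sum_{i=1}^n(-1)^i((a_1\ast a_i,\dots,a_{i-1}\ast a_i,a_{i+1},\dots,a_n)-(a_1,\dots,a_{i-1},a_{i+1}\circ a_i,\dots,a_n\circ a_i))$ ($n\ge2$), where $C'_n(S)$ is generated by $(a_1,\dots,a_i,a_{i+1},\dots,a_n)+(a_1,\dots,a_{i+1}\circ a_i,a_i\ast a_{i+1},\dots,a_n)$. $C^{SF}_\ast(S)=C_\ast(S)$ with boundary $d_n(a_1,\dots,a_n)=\sum_{i=1}^{n-1}(-1)^i((a_1,\dots,\widehat{a_i},\dots,a_n)-(a_1,\dots,\widehat{a_i},\dots,a_{n-1},a_n\circ a_i))$. Conditions (1),(2),(3) are exactly the cocycle conditions in these two complexes. Flat virtual link diagrams have flat crossings (no over/under information) and virtual crossings; flat Reidemeister moves are the generalized Reidemeister moves (classical, virtual $\Omega_1',\Omega_2',\Omega_3'$, and mixed $\Omega_3^s$) with real crossings replaced by flat crossings. A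 v-arc is a part of the diagram between consecutive virtual crossings. A coloring $\theta$ assigns an element of $S$ to each v-arc such that at each virtual crossing $\tau$, rotated so both strands point downward, if the incoming upper-left v-arc has color $a$ and the incoming upper-right v-arc has color $b$, then the outgoing arc continuing the upper-left strand has color $a\ast b$ and the outgoing arc continuing the upper-right strand has color $b\circ a$; the weight of $\tau$ is then $B(\tau,\theta)=\phi(a,b)\in A$. The state-sum is $\Phi_\phi(L)=\sum_\theta \big[\sum_\tau B(\tau,\theta)\big]\in\mathbb{Z}[A]$, where $[x]$ denotes the basis element of the group ring $\mathbb{Z}[A]$ corresponding to $x\in A$ (i.e. the product over virtual crossings of the weights, written multiplicatively in $\mathbb{Z}[A]$), the sum being over all colorings. *)

theory Defs
  imports Main "HOL-Library.FuncSet" "HOL-Library.Multiset" "HOL-Library.Poly_Mapping"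
begin

text \<open>We write star x a for x * a = S_a(x) and circ x a for x o a = T_a(x).\<close>

definition vflat_biquandle :: "('s \<Rightarrow> 's \<Rightarrow> 's) \<Rightarrow> ('s \<Rightarrow> 's \<Rightarrow> 's) \<Rightarrow> bool" where
  "vflat_biquandle star circ \<longleftrightarrow>
     (\<forall>a b x. star (star x b) a = star (star x a) b) \<and>
     (\<forall>a b x. circ (circ x b) a = circ (circ x a) b) \<and>
     (\<forall>a b x. star (circ x b) a = circ (star x a) b) \<and>
     (\<forall>a b x. star x a = star x (circ a b) \<and> star x a = star x (star a b)) \<and>
     (\<forall>a b x. circ x a = circ x (star a b) \<and> circ x a = circ x (circ a b)) \<and>
     (\<forall>a x. circ (star x a) a = x \<and> star (circ x a) a = x)"

text \<open>A diagram is a list of components; each component is the cyclic sequence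
  (in the direction of the orientation) of crossing passages.  A passage records the
  crossing label, whether the crossing is virtual (True) or flat (False), and whether
  the strand is the left one at that crossing (the strand entering from the upper left
  when the crossing is rotated so that both strands point downward).\<close>

datatype letter = Pass (lbl: nat) (virt: bool) (lft: bool)

type_synonym diagram = "letter list list"

definition wf_diagram :: "diagram \<Rightarrow> bool" where
  "wf_diagram D \<longleftrightarrow>
     (\<forall>c. let occ = filter (\<lambda>x. lbl x = c) (concat D) in
        occ = [] \<or> (length occ = 2 \<and> virt (occ ! 0) = virt (occ ! 1) \<and> lft (occ ! 0) \<noteq> lft (occ ! 1)))"

definition vseq :: "diagram \<Rightarrow> nat \<Rightarrow> letter list" where
  "vseq D i = filter virt (D ! i)"

definition voccs :: "diagram \<Rightarrow> (nat \<times> nat) set" where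
  "voccs D = {(i, k). i < length D \<and> k < length (vseq D i)}"

text \<open>v-arcs: (i,k) is the v-arc leaving the k-th virtual passage of component i;
  a component without virtual crossings is a single v-arc (i,0).\<close>
definition varcs :: "diagram \<Rightarrow> (nat \<times> nat) set" where
  "varcs D = {(i, k). i < length D \<and> k < max 1 (length (vseq D i))}"

definition inarc :: "diagram \<Rightarrow> nat \<times> nat \<Rightarrow> nat \<times> nat" where
  "inarc D p = (fst p, (snd p + length (vseq D (fst p)) - 1) mod length (vseq D (fst p)))"

definition vpairs :: "diagram \<Rightarrow> ((nat \<times> nat) \<times> (nat \<times> nat)) set" where
  "vpairs D = {(p, q). p \<in> voccs D \<and> q \<in> voccs D \<and>
      lbl (vseq D (fst p) ! snd p) = lbl (vseq D (fst q) ! snd q) \<and>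
      lft (vseq D (fst p) ! snd p) \<and> \<not> lft (vseq D (fst q) ! snd q)}"

definition colorings :: "('s \<Rightarrow> 's \<Rightarrow> 's) \<Rightarrow> ('s \<Rightarrow> 's \<Rightarrow> 's) \<Rightarrow> diagram
    \<Rightarrow> (nat \<times> nat \<Rightarrow> 's) set" where
  "colorings star circ D =
     {\<theta> \<in> varcs D \<rightarrow>\<^sub>E UNIV. \<forall>(p, q) \<in> vpairs D.
         \<theta> p = star (\<theta> (inarc D p)) (\<theta> (inarc D q)) \<and>
         \<theta> q = circ (\<theta> (inarc D q)) (\<theta> (inarc D p))}"

definition cweight :: "('s \<Rightarrow> 's \<Rightarrow> 'a::comm_monoid_add) \<Rightarrow> diagram \<Rightarrow> (nat \<times> nat \<Rightarrow> 's) \<Rightarrow> 'a" where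
  "cweight \<phi> D \<theta> = (\<Sum>(p, q) \<in> vpairs D. \<phi> (\<theta> (inarc D p)) (\<theta> (inarc D q)))"

text \<open>The state-sum in the group ring Z[A], modelled as finitely supported
  functions A \<Rightarrow>0 int (with convolution product); [x] = single x 1.\<close>
definition statesum :: "('s \<Rightarrow> 's \<Rightarrow> 's) \<Rightarrow> ('s \<Rightarrow> 's \<Rightarrow> 's) \<Rightarrow> ('s \<Rightarrow> 's \<Rightarrow> 'a::comm_monoid_add)
    \<Rightarrow> diagram \<Rightarrow> 'a \<Rightarrow>\<^sub>0 int" where
  "statesum star circ \<phi> D = (\<Sum>\<theta> \<in> colorings star circ D. Poly_Mapping.single (cweight \<phi> D \<theta>) 1)"

text \<open>Templates: a diagram with holes where the local strands of a move are inserted.\<close>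
datatype tsym = Lt letter | Hole nat

definition fill :: "tsym list list \<Rightarrow> (nat \<Rightarrow> letter list) \<Rightarrow> diagram" where
  "fill T f = map (\<lambda>w. concat (map (\<lambda>s. case s of Lt a \<Rightarrow> [a] | Hole k \<Rightarrow> f k) w)) T"

definition holes_ok :: "nat \<Rightarrow> tsym list list \<Rightarrow> bool" where
  "holes_ok n T \<longleftrightarrow> (\<forall>k. length (filter (\<lambda>s. s = Hole k) (concat T)) = (if k < n then 1 else 0))"

definition tlabels :: "tsym list list \<Rightarrow> nat set" where
  "tlabels T = {lbl a |a. Lt a \<in> set (concat T)}"

text \<open>Omega3 local words on the three strands (strand 0 meets strands 1,2 at x,y;
  strand 1 meets strand 2 at z).  o1,o2,o3 give the orders along the strands, p,q,r the
  sides; the side condition singles out exactly the configurations realised by three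
  oriented lines in the plane.  vx,vy,vz: virtual flags.\<close>
definition r3words :: "nat \<Rightarrow> nat \<Rightarrow> nat \<Rightarrow> bool \<Rightarrow> bool \<Rightarrow> bool \<Rightarrow> bool \<Rightarrow> bool \<Rightarrow> bool
    \<Rightarrow> bool \<Rightarrow> bool \<Rightarrow> bool \<Rightarrow> nat \<Rightarrow> letter list" where
  "r3words x y z vx vy vz o1 o2 o3 p q r k =
     (if k = 0 then (if o1 then [Pass x vx p, Pass y vy q] else [Pass y vy q, Pass x vx p])
      else if k = 1 then (if o2 then [Pass x vx (\<not> p), Pass z vz r] else [Pass z vz r, Pass x vx (\<not> p)])
      else (if o3 then [Pass y vy (\<not> q), Pass z vz (\<not> r)] else [Pass z vz (\<not> r), Pass y vy (\<not> q)]))"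

inductive local_move :: "diagram \<Rightarrow> diagram \<Rightarrow> bool" where
  omega1: "holes_ok 1 T \<Longrightarrow> c \<notin> tlabels T \<Longrightarrow>
     local_move (fill T (\<lambda>_. [])) (fill T (\<lambda>_. [Pass c v s, Pass c v (\<not> s)]))"
| omega2: "holes_ok 2 T \<Longrightarrow> c1 \<notin> tlabels T \<Longrightarrow> c2 \<notin> tlabels T \<Longrightarrow> c1 \<noteq> c2 \<Longrightarrow>
     w2 = [Pass c1 v (\<not> s), Pass c2 v s] \<or> w2 = [Pass c2 v s, Pass c1 v (\<not> s)] \<Longrightarrow>
     local_move (fill T (\<lambda>_. []))
                (fill T (\<lambda>k. if k = 0 then [Pass c1 v s, Pass c2 v (\<not> s)] else w2))"
| omega3: "holes_ok 3 T \<Longrightarrow> x \<notin> tlabels T \<Longrightarrow> y \<notin> tlabels T \<Longrightarrow> z \<notin> tlabels T \<Longrightarrow>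
     distinct [x, y, z] \<Longrightarrow>
     length (filter Not [vx, vy, vz]) \<in> {0, 1, 3} \<Longrightarrow>
     (p \<noteq> q) = (o2 \<noteq> o3) \<Longrightarrow> (p \<noteq> r) = (o1 \<noteq> o3) \<Longrightarrow>
     local_move (fill T (r3words x y z vx vy vz o1 o2 o3 p q r))
                (fill T (\<lambda>k. rev (r3words x y z vx vy vz o1 o2 o3 p q r k)))"
| relabel: "inj \<rho> \<Longrightarrow> local_move D (map (map (\<lambda>a. Pass (\<rho> (lbl a)) (virt a) (lft a))) D)"
| rotate: "i < length D \<Longrightarrow> local_move D (D[i := rotate1 (D ! i)])"
| permute: "mset D = mset D' \<Longrightarrow> local_move D D'"

definition flat_step :: "diagram \<Rightarrow> diagram \<Rightarrow> bool" where
  "flat_step D D' \<longleftrightarrow> wf_diagram D \<and> wf_diagram D' \<and> local_move D D'"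

definition flat_equiv :: "diagram \<Rightarrow> diagram \<Rightarrow> bool" where
  "flat_equiv = equivclp flat_step"

end

theory Submission
  imports Defs
begin

text \<open>A coloring is determined by the pair of colors entering each virtual crossing, subject to
  matching along every component, and its weight is a sum over the virtual crossings.  Hence,
  when a diagram is cut along the strands of a move, the state-sum becomes a bilinear pairing of
  an outer factor with a local state-sum that depends only on the colors at the ends of the
  strands.  It is enough to compare local state-sums.  A strand acts on the others by an operator
  that depends only on the orbit of its color, and all operators commute; so the end colors of
  the strands do not see the order of the crossings, and they determine the coloring inside.  For
  Omega1 the weight is its own negative by (1) and vanishes by the absence of 2-torsion, for
  Omega2 the two weights cancel by (1).  For Omega3 with all strands parallel the equality of weights is
  (2), or (3) if one crossing is flat; reversing a strand replaces each weight on it by its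
  negative at the outgoing colors, which is (1) again, and reduces the other orientations to this case.\<close>

section \<open>Colors travelling along words\<close>

text \<open>A letter with \<open>None\<close> is transparent, as flat crossings will be.
  \<open>Some (u, v)\<close> demands the color \<open>u\<close> on arrival and passes on
  \<open>v\<close>. Since the demand may fail, this is a partial transition rather than a function
  of the start color.\<close>

fun traverses :: "('x \<Rightarrow> ('s \<times> 's) option) \<Rightarrow> 'x list \<Rightarrow> 's \<Rightarrow> 's \<Rightarrow> bool" where
  "traverses io [] a b \<longleftrightarrow> a = b"
| "traverses io (x # w) a b \<longleftrightarrow>
     (case io x of None \<Rightarrow> traverses io w a b | Some (u, v) \<Rightarrow> u = a \<and> traverses io w v b)"

lemma traverses_append:
  "traverses io (u @ v) a b \<longleftrightarrow> (\<exists>c. traverses io u a c \<and> traverses io v c b)"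
  by (induction u arbitrary: a) (auto split: option.splits)

lemma traverses_deterministic:
  "traverses io w a b \<Longrightarrow> traverses io w a c \<Longrightarrow> b = c"
  by (induction w arbitrary: a) (auto split: option.splits)

lemma traverses_cong:
  "(\<And>x. x \<in> set w \<Longrightarrow> io x = io' x) \<Longrightarrow> traverses io w a b \<longleftrightarrow> traverses io' w a b"
  by (induction w arbitrary: a) (auto split: option.splits)

lemma traverses_map:
  "traverses io (map f w) a b \<longleftrightarrow> traverses (io \<circ> f) w a b"
  by (induction w arbitrary: a) (auto split: option.splits)

lemma traverses_filter:
  "(\<And>x. \<not> P x \<Longrightarrow> io x = None) \<Longrightarrow> traverses io (filter P w) a b \<longleftrightarrow> traverses io w a b"
  by (induction w arbitrary: a) (auto split: option.splits)

lemma traverses_nth: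
  assumes "\<And>x. x \<in> set w \<Longrightarrow> io x = Some (i x, j x)" and "w \<noteq> []"
  shows "traverses io w a b \<longleftrightarrow>
    a = i (w ! 0) \<and> (\<forall>k. Suc k < length w \<longrightarrow> i (w ! Suc k) = j (w ! k)) \<and> b = j (w ! (length w - 1))"
  using assms
proof (induction w arbitrary: a)
  case (Cons x w)
  show ?case
  proof (cases w)
    case Nil
    then show ?thesis using Cons.prems by auto
  next
    case (Cons y u)
    then have "traverses io w (j x) b \<longleftrightarrow> j x = i (w ! 0) \<and>
      (\<forall>k. Suc k < length w \<longrightarrow> i (w ! Suc k) = j (w ! k)) \<and> b = j (w ! (length w - 1))"
      using Cons.IH Cons.prems by auto
    moreover have "(\<forall>k. Suc k < length (x # w) \<longrightarrow> i ((x # w) ! Suc k) = j ((x # w) ! k)) \<longleftrightarrow>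
      i (w ! 0) = j x \<and> (\<forall>k. Suc k < length w \<longrightarrow> i (w ! Suc k) = j (w ! k))"
      using Cons by (auto simp: All_less_Suc2 nth_Cons split: nat.splits)
    ultimately show ?thesis using Cons Cons.prems by auto
  qed
qed simp

text \<open>The index shift is the cyclic predecessor used by \<open>inarc\<close>: at
  \<open>k = 0\<close> it wraps around to the last letter and gives the closing-up condition,
  elsewhere it gives the matching of consecutive letters.\<close>

lemma traverses_cyclic:
  assumes "\<And>x. x \<in> set w \<Longrightarrow> io x = Some (i x, j x)" and "w \<noteq> []"
  shows "traverses io w a a \<longleftrightarrow> a = j (w ! (length w - 1)) \<and>
    (\<forall>k < length w. i (w ! k) = j (w ! ((k + length w - 1) mod length w)))"
proof -
  have *: "(\<forall>k < length w. P k) \<longleftrightarrow> P 0 \<and> (\<forall>k. Suc k < length w \<longrightarrow> P (Suc k))" for P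
    using assms(2) by (metis Suc_lessD length_greater_0_conv not0_implies_Suc)
  have "(Suc k + length w - 1) mod length w = k" if "Suc k < length w" for k
    using that by simp
  then have "(\<forall>k < length w. i (w ! k) = j (w ! ((k + length w - 1) mod length w))) \<longleftrightarrow>
      i (w ! 0) = j (w ! (length w - 1)) \<and> (\<forall>k. Suc k < length w \<longrightarrow> i (w ! Suc k) = j (w ! k))"
    using assms(2) unfolding *[of "\<lambda>k. i (w ! k) = j (w ! ((k + length w - 1) mod length w))"] by simp
  moreover have "traverses io w a a \<longleftrightarrow>
      a = i (w ! 0) \<and> (\<forall>k. Suc k < length w \<longrightarrow> i (w ! Suc k) = j (w ! k)) \<and> a = j (w ! (length w - 1))"
    by (rule traverses_nth) (use assms in auto)
  ultimately show ?thesis by auto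
qed

text \<open>The possible colors at the base point of a cyclic word. One letter that is not
  transparent leaves at most one such color; a word of transparent letters admits every color.
  Counting closings therefore treats components without virtual crossings uniformly with the
  rest.\<close>

definition closings :: "('x \<Rightarrow> ('s \<times> 's) option) \<Rightarrow> 'x list \<Rightarrow> 's set" where
  "closings io w = {a. traverses io w a a}"

text \<open>The set of closings can change but not its size: moving the base point past a letter
  with \<open>Some (i, j)\<close> replaces the only candidate \<open>i\<close> by
  \<open>j\<close>.\<close>

lemma card_closings_rotate1:
  "card (closings io (rotate1 w)) = card (closings io w)"
proof (cases w)
  case (Cons x u)
  show ?thesis
  proof (cases "io x")
    case None
    then show ?thesis using Cons by (auto simp: closings_def traverses_append)
  next
    case (Some p)
    obtain i j where p: "p = (i, j)" by fastforce
    have "closings io w = (if traverses io u j i then {i} else {})"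
      using Cons Some p by (auto simp: closings_def)
    moreover have "closings io (rotate1 w) = (if traverses io u j i then {j} else {})"
      using Cons Some p by (auto simp: closings_def traverses_append)
    ultimately show ?thesis by simp
  qed
qed simp

lemma card_list_all2:
  fixes F :: "'x \<Rightarrow> 's::finite set"
  shows "card {hs. list_all2 (\<lambda>w a. a \<in> F w) D hs} = (\<Prod>w\<leftarrow>D. card (F w))"
proof (induction D)
  case (Cons w D)
  have "{hs. list_all2 (\<lambda>w a. a \<in> F w) (w # D) hs}
      = (\<lambda>(a, hs). a # hs) ` (F w \<times> {hs. list_all2 (\<lambda>w a. a \<in> F w) D hs})"
    by (auto simp: list_all2_Cons1)
  moreover have "inj_on (\<lambda>(a, hs). a # hs) (F w \<times> {hs. list_all2 (\<lambda>w a. a \<in> F w) D hs})"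
    by (auto simp: inj_on_def)
  ultimately show ?case
    using Cons by (simp add: card_image card_cartesian_product)
qed simp

section \<open>Crossing operators, labels and well-formed diagrams\<close>

definition act :: "('s \<Rightarrow> 's \<Rightarrow> 's) \<Rightarrow> ('s \<Rightarrow> 's \<Rightarrow> 's) \<Rightarrow> bool \<Rightarrow> 's \<Rightarrow> 's \<Rightarrow> 's" where
  "act star circ s b a = (if s then star a b else circ a b)"

text \<open>A coloring is recorded by the colors entering each virtual crossing:
  g c True from the upper left, g c False from the upper right.\<close>

definition strand_io :: "('s \<Rightarrow> 's \<Rightarrow> 's) \<Rightarrow> ('s \<Rightarrow> 's \<Rightarrow> 's) \<Rightarrow> (nat \<Rightarrow> bool \<Rightarrow> 's)
    \<Rightarrow> letter \<Rightarrow> ('s \<times> 's) option" where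
  "strand_io star circ g l = (if virt l
     then Some (g (lbl l) (lft l), act star circ (lft l) (g (lbl l) (\<not> lft l)) (g (lbl l) (lft l)))
     else None)"

definition vlabels :: "letter list \<Rightarrow> nat set" where
  "vlabels w = lbl ` {l \<in> set w. virt l}"

lemma vlabels_simps [simp]:
  "vlabels [] = {}"
  "vlabels (l # w) = (if virt l then insert (lbl l) (vlabels w) else vlabels w)"
proof -
  have "{x \<in> set (l # w). virt x} = (if virt l then insert l {x \<in> set w. virt x} else {x \<in> set w. virt x})"
    by auto
  then show "vlabels (l # w) = (if virt l then insert (lbl l) (vlabels w) else vlabels w)"
    by (simp add: vlabels_def)
qed (simp add: vlabels_def)

lemma finite_vlabels [simp]: "finite (vlabels w)"
  by (simp add: vlabels_def)

definition gweight :: "('s \<Rightarrow> 's \<Rightarrow> 'a::comm_monoid_add) \<Rightarrow> nat set \<Rightarrow> (nat \<Rightarrow> bool \<Rightarrow> 's) \<Rightarrow> 'a" where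
  "gweight \<phi> L g = (\<Sum>c\<in>L. \<phi> (g c True) (g c False))"

text \<open>Two passages with the same label lie on different sides, so they are different
  letters.\<close>

lemma wf_diagram_distinct: 
  assumes "wf_diagram D" shows "distinct (concat D)"
proof -
  have "count (mset (concat D)) l \<le> 1" for l
  proof (rule ccontr)
    assume "\<not> ?thesis"
    moreover define occ where "occ = filter (\<lambda>x. lbl x = lbl l) (concat D)"
    have "count (mset occ) l = count (mset (concat D)) l" by (simp add: occ_def mset_filter)
    ultimately have c: "2 \<le> count (mset occ) l" by simp
    then have "occ \<noteq> []" by auto
    then have *: "length occ = 2" "lft (occ ! 0) \<noteq> lft (occ ! 1)"
      using assms unfolding wf_diagram_def occ_def Let_def by blast+
    then obtain x y where "occ = [x, y]" by (auto simp: length_Suc_conv numeral_2_eq_2)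
    then show False using c * by (auto split: if_splits)
  qed
  then show ?thesis
    by (metis One_nat_def count_mset_0_iff distinct_count_atmost_1 le_0_eq le_Suc_eq)
qed

lemma wf_diagram_partner:
  assumes "wf_diagram D" and "Pass c v s \<in> set (concat D)"
  shows "Pass c v (\<not> s) \<in> set (concat D)"
proof -
  define occ where "occ = filter (\<lambda>x. lbl x = c) (concat D)"
  have mem: "Pass c v s \<in> set occ" using assms by (auto simp: occ_def)
  then have *: "length occ = 2" "virt (occ ! 0) = virt (occ ! 1)" "lft (occ ! 0) \<noteq> lft (occ ! 1)"
    using assms(1) unfolding wf_diagram_def occ_def Let_def by (metis empty_iff empty_set)+
  then obtain x y where xy: "occ = [x, y]" by (auto simp: length_Suc_conv numeral_2_eq_2)
  have "lbl x = c" "lbl y = c" 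
  proof -
    have "set occ \<subseteq> {l. lbl l = c}" by (auto simp: occ_def)
    then show "lbl x = c" "lbl y = c" using xy by auto
  qed
  then have "Pass c v (\<not> s) \<in> set occ" using mem * xy by (cases x; cases y) auto
  then show ?thesis by (auto simp: occ_def)
qed

subsection \<open>Colorings by incoming colors at the crossings\<close>

lemma single_sum_const:
  "Poly_Mapping.single x (\<Sum>i\<in>A. f i) = (\<Sum>i\<in>A. Poly_Mapping.single x (f i :: 'b::comm_monoid_add))"
  by (induction A rule: infinite_finite_induct) (auto simp: single_add)

definition vletter :: "diagram \<Rightarrow> nat \<times> nat \<Rightarrow> letter" where
  "vletter D p = vseq D (fst p) ! snd p"

lemma vletter_in_set:
  assumes "p \<in> voccs D" shows "vletter D p \<in> set (concat D)" "virt (vletter D p)"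
proof -
  have "vletter D p \<in> set (vseq D (fst p))" "fst p < length D"
    using assms by (auto simp: vletter_def voccs_def)
  then show "vletter D p \<in> set (concat D)" "virt (vletter D p)"
    by (auto simp: vseq_def)
qed

lemma distinct_concat_nth:
  assumes "distinct (concat D)" "i < length D" "j < length D" "x \<in> set (D ! i)" "x \<in> set (D ! j)"
  shows "i = j"
  using assms
proof (induction D arbitrary: i j)
  case (Cons w D)
  have "x \<notin> set w" if "k < length D" "x \<in> set (D ! k)" for k
    using Cons.prems(1) that nth_mem[of k D] by (auto simp: disjoint_iff)
  then show ?case using Cons by (cases i; cases j) auto
qed simp

lemma distinct_concat_component:
  "distinct (concat D) \<Longrightarrow> i < length D \<Longrightarrow> distinct (D ! i)"
  by (induction D arbitrary: i) (auto simp: nth_Cons split: nat.splits)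

text \<open>No letter repeats in a well-formed diagram, so a virtual passage can be recovered from
  its letter. This makes \<open>vpos\<close> below an inverse of \<open>vletter\<close>.\<close>

lemma inj_on_vletter:
  assumes "wf_diagram D" shows "inj_on (vletter D) (voccs D)"
proof (rule inj_onI)
  fix p q assume p: "p \<in> voccs D" and q: "q \<in> voccs D" and eq: "vletter D p = vletter D q"
  have d: "distinct (concat D)" using assms by (rule wf_diagram_distinct)
  obtain i k where pp: "p = (i, k)" by fastforce
  obtain j m where qq: "q = (j, m)" by fastforce
  have lt: "i < length D" "j < length D" "k < length (vseq D i)" "m < length (vseq D j)"
    using p q pp qq by (auto simp: voccs_def)
  have v: "vseq D i ! k \<in> set (D ! i)" "vseq D j ! m \<in> set (D ! j)" 
    using lt nth_mem[of k "vseq D i"] nth_mem[of m "vseq D j"] by (auto simp: vseq_def)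
  have "i = j" using distinct_concat_nth[OF d lt(1,2) v(1)] v eq pp qq by (auto simp: vletter_def)
  moreover have "distinct (vseq D i)"
    using distinct_concat_component[OF d] lt by (simp add: vseq_def)
  ultimately show "p = q" using eq pp qq lt by (auto simp: vletter_def nth_eq_iff_index_eq)
qed

lemma ex_voccs:
  assumes "wf_diagram D" "c \<in> vlabels (concat D)"
  shows "\<exists>p\<in>voccs D. vletter D p = Pass c True s"
proof -
  obtain l where "l \<in> set (concat D)" "virt l" "lbl l = c" using assms by (auto simp: vlabels_def)
  then have "Pass c True (lft l) \<in> set (concat D)" by (metis letter.collapse)
  then have "Pass c True s \<in> set (concat D)"
    using wf_diagram_partner[OF assms(1), of c True "lft l"] by (cases "s = lft l") auto
  then obtain i where i: "i < length D" "Pass c True s \<in> set (D ! i)"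
    by (auto simp: in_set_conv_nth[of _ D])
  then have "Pass c True s \<in> set (vseq D i)" by (auto simp: vseq_def)
  then obtain k where "k < length (vseq D i)" "vseq D i ! k = Pass c True s"
    by (auto simp: in_set_conv_nth)
  then show ?thesis using i by (intro bexI[of _ "(i, k)"]) (auto simp: vletter_def voccs_def)
qed

definition vpos :: "diagram \<Rightarrow> nat \<Rightarrow> bool \<Rightarrow> nat \<times> nat" where
  "vpos D c s = (THE p. p \<in> voccs D \<and> vletter D p = Pass c True s)"

lemma vpos_eq:
  assumes "wf_diagram D" "p \<in> voccs D" "vletter D p = Pass c True s"
  shows "vpos D c s = p"
  unfolding vpos_def
  by (rule the_equality) (use assms inj_onD[OF inj_on_vletter[OF assms(1)]] in \<open>metis\<close>)+

lemma vpos_props: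
  assumes "wf_diagram D" "c \<in> vlabels (concat D)"
  shows "vpos D c s \<in> voccs D" "vletter D (vpos D c s) = Pass c True s"
  using ex_voccs[OF assms, of s] vpos_eq[OF assms(1), of _ c s] by auto

lemma lbl_vletter:
  assumes "p \<in> voccs D"
  shows "lbl (vletter D p) \<in> vlabels (concat D)"
  using vletter_in_set[OF assms] by (auto simp: vlabels_def)

text \<open>Virtual crossings become indexed by their labels, so that conditions and weights can be
  taken over a set of labels instead of pairs of positions.\<close>

lemma vpairs_eq:
  assumes "wf_diagram D"
  shows "vpairs D = (\<lambda>c. (vpos D c True, vpos D c False)) ` vlabels (concat D)"
proof (intro equalityI subsetI)
  fix x assume "x \<in> vpairs D"
  then obtain p q where x: "x = (p, q)" "p \<in> voccs D" "q \<in> voccs D"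
    "lbl (vletter D p) = lbl (vletter D q)" "lft (vletter D p)" "\<not> lft (vletter D q)"
    unfolding vpairs_def vletter_def by blast
  define c where "c = lbl (vletter D p)"
  have "vletter D p = Pass c True True" "vletter D q = Pass c True False"
    using x vletter_in_set(2)[of p D] vletter_in_set(2)[of q D]
    by (cases "vletter D p"; cases "vletter D q"; auto simp: c_def)+
  then have "vpos D c True = p" "vpos D c False = q" using vpos_eq assms x by auto
  then show "x \<in> (\<lambda>c. (vpos D c True, vpos D c False)) ` vlabels (concat D)"
    using x lbl_vletter[of p D] by (auto simp: c_def[symmetric])
next
  fix x assume "x \<in> (\<lambda>c. (vpos D c True, vpos D c False)) ` vlabels (concat D)"
  then obtain c where c: "c \<in> vlabels (concat D)" "x = (vpos D c True, vpos D c False)" by auto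
  show "x \<in> vpairs D"
    using c vpos_props[OF assms c(1), of True] vpos_props[OF assms c(1), of False]
    by (auto simp: vpairs_def vletter_def)
qed

lemma cweight_eq:
  assumes "wf_diagram D"
  shows "cweight \<phi> D \<theta> = (\<Sum>c\<in>vlabels (concat D).
    \<phi> (\<theta> (inarc D (vpos D c True))) (\<theta> (inarc D (vpos D c False))))"
proof -
  have "inj_on (\<lambda>c. (vpos D c True, vpos D c False)) (vlabels (concat D))"
    by (rule inj_onI) (metis assms prod.inject vpos_props(2) letter.inject)
  then show ?thesis
    unfolding cweight_def vpairs_eq[OF assms] by (simp add: sum.reindex)
qed

lemma colorings_eq:
  assumes "wf_diagram D"
  shows "colorings star circ D = {\<theta> \<in> varcs D \<rightarrow>\<^sub>E UNIV. \<forall>c\<in>vlabels (concat D). \<forall>s.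
    \<theta> (vpos D c s) = act star circ s (\<theta> (inarc D (vpos D c (\<not> s)))) (\<theta> (inarc D (vpos D c s)))}"
  unfolding colorings_def vpairs_eq[OF assms] by (auto simp: act_def all_bool_eq)

definition out_color :: "('s \<Rightarrow> 's \<Rightarrow> 's) \<Rightarrow> ('s \<Rightarrow> 's \<Rightarrow> 's) \<Rightarrow> (nat \<Rightarrow> bool \<Rightarrow> 's) \<Rightarrow> letter \<Rightarrow> 's" where
  "out_color star circ g l = act star circ (lft l) (g (lbl l) (\<not> lft l)) (g (lbl l) (lft l))"

text \<open>An arc is named after the passage it leaves, hence carries the outgoing color there. The
  list \<open>hs\<close> of base colors is consulted only for components without virtual passages,
  whose single arc is seen by no crossing.\<close>

definition arc_coloring :: "('s \<Rightarrow> 's \<Rightarrow> 's) \<Rightarrow> ('s \<Rightarrow> 's \<Rightarrow> 's) \<Rightarrow> diagram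
    \<Rightarrow> (nat \<Rightarrow> bool \<Rightarrow> 's) \<times> 's list \<Rightarrow> nat \<times> nat \<Rightarrow> 's" where
  "arc_coloring star circ D = (\<lambda>(g, hs). \<lambda>p\<in>varcs D.
     if vseq D (fst p) = [] then hs ! fst p else out_color star circ g (vletter D p))"

text \<open>The arc \<open>inarc D (i, 0)\<close> contains the base point of component
  \<open>i\<close>. If the component has no virtual passage, truncated subtraction and
  \<open>mod 0\<close> make it the arc \<open>(i, 0)\<close> itself.\<close>

definition crossing_coloring :: "diagram \<Rightarrow> (nat \<times> nat \<Rightarrow> 's) \<Rightarrow> (nat \<Rightarrow> bool \<Rightarrow> 's) \<times> 's list" where
  "crossing_coloring D \<theta> =
     (\<lambda>c\<in>vlabels (concat D). \<lambda>s. \<theta> (inarc D (vpos D c s)),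
      map (\<lambda>i. \<theta> (inarc D (i, 0))) [0..<length D])"

lemma inarc_in_varcs:
  assumes "fst p < length D" "snd p < max 1 (length (vseq D (fst p)))"
  shows "inarc D p \<in> varcs D"
  using assms by (cases "vseq D (fst p) = []") (auto simp: inarc_def varcs_def less_max_iff_disj)

lemma voccs_subset_varcs: "voccs D \<subseteq> varcs D"
  by (auto simp: voccs_def varcs_def)

text \<open>Going once around a component compares each demanded incoming color with the outgoing
  color of the preceding virtual passage; this translates the word formalism into the arc
  formalism.\<close>

lemma list_all2_closings_iff:
  "list_all2 (\<lambda>w a. a \<in> closings (strand_io star circ g) w) D hs \<longleftrightarrow>
    length hs = length D \<and>
    (\<forall>i<length D. hs ! i = arc_coloring star circ D (g, hs) (inarc D (i, 0))) \<and>
    (\<forall>p\<in>voccs D. g (lbl (vletter D p)) (lft (vletter D p)) = arc_coloring star circ D (g, hs) (inarc D p))"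
proof -
  let ?\<theta> = "arc_coloring star circ D (g, hs)"
  let ?in = "\<lambda>l. g (lbl l) (lft l)"
  have component: "a \<in> closings (strand_io star circ g) (D ! i) \<longleftrightarrow>
      a = ?\<theta> (inarc D (i, 0)) \<and> (\<forall>k<length (vseq D i). ?in (vletter D (i, k)) = ?\<theta> (inarc D (i, k)))"
    if i: "i < length D" and a: "a = hs ! i" for i a
  proof (cases "vseq D i = []")
    case True
    have "traverses (strand_io star circ g) (vseq D i) a a \<longleftrightarrow> traverses (strand_io star circ g) (D ! i) a a"
      unfolding vseq_def by (rule traverses_filter) (simp add: strand_io_def)
    then show ?thesis using True i a by (simp add: closings_def arc_coloring_def inarc_def varcs_def)
  next
    case False
    let ?n = "length (vseq D i)"
    have "traverses (strand_io star circ g) (D ! i) a a \<longleftrightarrow> traverses (strand_io star circ g) (vseq D i) a a"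
      unfolding vseq_def by (rule traverses_filter[symmetric]) (simp add: strand_io_def)
    also have "\<dots> \<longleftrightarrow> a = out_color star circ g (vseq D i ! (?n - 1)) \<and>
        (\<forall>k<?n. ?in (vseq D i ! k) = out_color star circ g (vseq D i ! ((k + ?n - 1) mod ?n)))"
      by (rule traverses_cyclic)
        (use False in \<open>auto simp: strand_io_def out_color_def vseq_def\<close>)
    also have "\<dots> \<longleftrightarrow> a = ?\<theta> (inarc D (i, 0)) \<and> (\<forall>k<?n. ?in (vletter D (i, k)) = ?\<theta> (inarc D (i, k)))"
    proof -
      have "?\<theta> (inarc D (i, k)) = out_color star circ g (vseq D i ! ((k + ?n - 1) mod ?n))" if "k < ?n" for k
        using inarc_in_varcs[of "(i, k)" D] i that False
        by (simp add: arc_coloring_def vletter_def) (simp add: inarc_def)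
      moreover have "(0 + ?n - 1) mod ?n = ?n - 1" using False by simp
      ultimately show ?thesis using False by (auto simp: vletter_def)
    qed
    finally show ?thesis by (simp add: closings_def)
  qed
  show ?thesis
    unfolding list_all2_conv_all_nth using component by (auto simp: voccs_def)
qed

text \<open>Colorings correspond to pairs of a crossing coloring \<open>g\<close> and a list of base
  colors that close up. The weight depends on \<open>g\<close> alone, so the base colors enter only
  through their number, which becomes the integer coefficient.\<close>

lemma statesum_crossing_colorings:
  fixes star circ :: "'s::finite \<Rightarrow> 's \<Rightarrow> 's" and \<phi> :: "'s \<Rightarrow> 's \<Rightarrow> 'a::comm_monoid_add"
  assumes wf: "wf_diagram D"
  shows "statesum star circ \<phi> D = (\<Sum>g \<in> vlabels (concat D) \<rightarrow>\<^sub>E UNIV.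
    Poly_Mapping.single (gweight \<phi> (vlabels (concat D)) g)
      (int (\<Prod>w\<leftarrow>D. card (closings (strand_io star circ g) w))))"
proof -
  let ?L = "vlabels (concat D)"
  let ?H = "\<lambda>g. {hs. list_all2 (\<lambda>w a. a \<in> closings (strand_io star circ g) w) D hs}"
  let ?C = "Sigma (?L \<rightarrow>\<^sub>E UNIV) ?H"
  have fin: "finite (?H g)" for g
    by (rule finite_subset[OF _ finite_lists_length_eq[of UNIV "length D"]]) (auto simp: list_all2_conv_all_nth)
  have "(\<Sum>g \<in> ?L \<rightarrow>\<^sub>E UNIV. Poly_Mapping.single (gweight \<phi> ?L g)
      (int (\<Prod>w\<leftarrow>D. card (closings (strand_io star circ g) w))))
    = (\<Sum>g \<in> ?L \<rightarrow>\<^sub>E UNIV. \<Sum>hs\<in>?H g. Poly_Mapping.single (gweight \<phi> ?L g) 1)"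
    by (subst single_sum_const[symmetric]) (simp add: card_list_all2)
  also have "\<dots> = (\<Sum>(g, hs)\<in>?C. Poly_Mapping.single (gweight \<phi> ?L g) 1)"
    by (rule sum.Sigma) (auto intro: finite_PiE fin)
  \<comment> \<open>\<open>crossing_coloring D\<close> and \<open>arc_coloring star circ D\<close>
    are mutually inverse between the two index sets and preserve the weight.\<close>
  also have "\<dots> = (\<Sum>\<theta> \<in> colorings star circ D. Poly_Mapping.single (cweight \<phi> D \<theta>) 1)"
  proof (rule sum.reindex_bij_witness[where i = "crossing_coloring D" and j = "arc_coloring star circ D"])
    fix x assume C: "x \<in> ?C"
    obtain g hs where x: "x = (g, hs)" by fastforce
    have g: "g \<in> ?L \<rightarrow>\<^sub>E UNIV" and len: "length hs = length D"
      and hs: "\<And>i. i < length D \<Longrightarrow> arc_coloring star circ D x (inarc D (i, 0)) = hs ! i"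
      and p: "\<And>p. p \<in> voccs D \<Longrightarrow>
        arc_coloring star circ D x (inarc D p) = g (lbl (vletter D p)) (lft (vletter D p))"
      using C unfolding x list_all2_closings_iff by auto
    have in_color: "arc_coloring star circ D x (inarc D (vpos D c s)) = g c s" if "c \<in> ?L" for c s
      using p[of "vpos D c s"] vpos_props[OF wf that] by simp
    have "(\<lambda>c\<in>?L. \<lambda>s. arc_coloring star circ D x (inarc D (vpos D c s))) = g"
      by (rule extensionalityI[of _ ?L]) (use g in_color in \<open>auto simp: PiE_def\<close>)
    moreover have "map (\<lambda>i. arc_coloring star circ D x (inarc D (i, 0))) [0..<length D] = hs"
      by (rule nth_equalityI) (auto simp: len hs)
    ultimately show "crossing_coloring D (arc_coloring star circ D x) = x"
      by (simp add: crossing_coloring_def x)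
    have "arc_coloring star circ D x (vpos D c s) = act star circ s (g c (\<not> s)) (g c s)" if "c \<in> ?L" for c s
      using vpos_props[OF wf that, of s] voccs_subset_varcs[of D]
      by (auto simp: arc_coloring_def x out_color_def) (auto simp: voccs_def)
    then show "arc_coloring star circ D x \<in> colorings star circ D"
      unfolding colorings_eq[OF wf] using in_color by (auto simp: arc_coloring_def x)
    show "Poly_Mapping.single (cweight \<phi> D (arc_coloring star circ D x)) 1 =
        (case x of (g, hs) \<Rightarrow> Poly_Mapping.single (gweight \<phi> ?L g) (1::int))"
      by (simp add: x cweight_eq[OF wf] gweight_def in_color[unfolded x])
  next
    fix \<theta> assume \<theta>: "\<theta> \<in> colorings star circ D"
    obtain g hs where gh: "crossing_coloring D \<theta> = (g, hs)" by fastforce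
    have g: "g c s = \<theta> (inarc D (vpos D c s))" if "c \<in> ?L" for c s
      using gh that by (auto simp: crossing_coloring_def)
    have hs: "hs = map (\<lambda>i. \<theta> (inarc D (i, 0))) [0..<length D]"
      using gh by (auto simp: crossing_coloring_def)
    have letter: "vletter D p = Pass (lbl (vletter D p)) True (lft (vletter D p))"
      "vpos D (lbl (vletter D p)) (lft (vletter D p)) = p" if "p \<in> voccs D" for p
    proof -
      show *: "vletter D p = Pass (lbl (vletter D p)) True (lft (vletter D p))"
        using vletter_in_set(2)[OF that] by (cases "vletter D p") auto
      show "vpos D (lbl (vletter D p)) (lft (vletter D p)) = p"
        by (rule vpos_eq[OF wf that *])
    qed
    have out: "\<theta> p = out_color star circ g (vletter D p)" if "p \<in> voccs D" for p
      using \<theta> letter[OF that] lbl_vletter[OF that] g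
      unfolding colorings_eq[OF wf] out_color_def by auto metis
    show inv: "arc_coloring star circ D (crossing_coloring D \<theta>) = \<theta>"
    proof (rule extensionalityI)
      show "arc_coloring star circ D (crossing_coloring D \<theta>) \<in> extensional (varcs D)"
        by (auto simp: arc_coloring_def split: prod.splits)
      show "\<theta> \<in> extensional (varcs D)" using \<theta> by (auto simp: colorings_def PiE_def)
      fix p assume p: "p \<in> varcs D"
      show "arc_coloring star circ D (crossing_coloring D \<theta>) p = \<theta> p"
      proof (cases "vseq D (fst p) = []")
        case True
        then have "inarc D (fst p, 0) = p" using p by (auto simp: varcs_def inarc_def)
        then show ?thesis using True p by (auto simp: gh arc_coloring_def hs varcs_def)
      next
        case False
        then have "p \<in> voccs D" using p by (auto simp: varcs_def voccs_def less_max_iff_disj)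
        then show ?thesis using False p out by (auto simp: gh arc_coloring_def)
      qed
    qed
    have "g \<in> ?L \<rightarrow>\<^sub>E UNIV" using gh by (auto simp: crossing_coloring_def)
    moreover have "hs \<in> ?H g"
      using inv letter lbl_vletter g by (simp add: list_all2_closings_iff gh) (simp add: hs)
    ultimately show "crossing_coloring D \<theta> \<in> ?C" by (simp add: gh)
  qed
  finally show ?thesis by (simp add: statesum_def)
qed

subsection \<open>Cutting a diagram along a move\<close>

definition fill_word :: "(nat \<Rightarrow> letter list) \<Rightarrow> tsym list \<Rightarrow> letter list" where
  "fill_word f w = concat (map (\<lambda>s. case s of Lt a \<Rightarrow> [a] | Hole k \<Rightarrow> f k) w)"

lemma fill_word_simps [simp]:
  "fill_word f [] = []"
  "fill_word f (Lt a # w) = a # fill_word f w"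
  "fill_word f (Hole k # w) = f k @ fill_word f w"
  by (auto simp: fill_word_def)

lemma fill_eq: "fill T f = map (fill_word f) T"
  by (simp add: fill_def fill_word_def)

text \<open>A hole acts as one opaque letter: \<open>h k\<close> records only the colors at the two
  ends of the strand inserted there.\<close>

definition template_io :: "(letter \<Rightarrow> ('s \<times> 's) option) \<Rightarrow> (nat \<Rightarrow> 's \<times> 's) \<Rightarrow> tsym \<Rightarrow> ('s \<times> 's) option" where
  "template_io io h s = (case s of Lt l \<Rightarrow> io l | Hole k \<Rightarrow> Some (h k))"

lemma template_io_simps [simp]:
  "template_io io h (Lt l) = io l"
  "template_io io h (Hole k) = Some (h k)"
  by (simp_all add: template_io_def)

definition crosses :: "(letter \<Rightarrow> ('s \<times> 's) option) \<Rightarrow> letter list \<Rightarrow> 's \<times> 's \<Rightarrow> bool" where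
  "crosses io w p \<longleftrightarrow> traverses io w (fst p) (snd p)"

lemma traverses_fill_wordI:
  assumes "traverses (template_io io h) w a b" "\<And>k. Hole k \<in> set w \<Longrightarrow> crosses io (f k) (h k)"
  shows "traverses io (fill_word f w) a b"
  using assms
proof (induction w arbitrary: a)
  case (Cons s w)
  have IH: "traverses (template_io io h) w a b \<Longrightarrow> traverses io (fill_word f w) a b" for a
    using Cons by simp
  show ?case
  proof (cases s)
    case (Lt l)
    then show ?thesis using Cons.prems(1) by (auto split: option.splits dest: IH)
  next
    case (Hole k)
    then have "traverses io (f k) a (snd (h k))" "traverses io (fill_word f w) (snd (h k)) b"
      using Cons.prems(1) Cons.prems(2)[of k] by (auto simp: crosses_def split: prod.splits dest: IH)
    then show ?thesis using Hole by (auto simp: traverses_append)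
  qed
qed simp

text \<open>The colors at the ends of each hole are read off during the traversal. They fit into one
  function \<open>h\<close> because no hole occurs twice; a repeated hole could be passed with two
  different pairs.\<close>

lemma traverses_fill_wordD:
  assumes "traverses io (fill_word f w) a b" "\<And>k. length (filter (\<lambda>s. s = Hole k) w) \<le> 1"
  shows "\<exists>h. traverses (template_io io h) w a b \<and> (\<forall>k. Hole k \<in> set w \<longrightarrow> crosses io (f k) (h k))"
  using assms
proof (induction w arbitrary: a)
  case (Cons s w)
  have le: "length (filter (\<lambda>s. s = Hole k) w) \<le> 1" for k
    using Cons.prems(2)[of k] by (auto split: if_splits)
  show ?case
  proof (cases s)
    case (Lt l)
    show ?thesis
    proof (cases "io l")
      case None
      then show ?thesis using Lt Cons.IH[OF _ le] Cons.prems(1) by auto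
    next
      case (Some p)
      then show ?thesis using Lt Cons.IH[OF _ le, of "snd p"] Cons.prems(1)
        by (cases p) auto
    qed
  next
    case (Hole k)
    then obtain c where c: "traverses io (f k) a c" "traverses io (fill_word f w) c b"
      using Cons.prems(1) by (auto simp: traverses_append)
    then obtain h where h: "traverses (template_io io h) w c b"
      "\<forall>k. Hole k \<in> set w \<longrightarrow> crosses io (f k) (h k)"
      using Cons.IH[OF _ le] by blast
    have fresh: "Hole k \<notin> set w" using Cons.prems(2)[of k] Hole by (auto simp: filter_empty_conv)
    have "traverses (template_io io (h(k := (a, c)))) w c b"
      using h(1) by (rule traverses_cong[THEN iffD1, rotated])
        (use fresh in \<open>auto simp: template_io_def split: tsym.splits\<close>)
    then show ?thesis using Hole h c fresh
      by (intro exI[of _ "h(k := (a, c))"]) (auto simp: crosses_def simp del: fun_upd_apply, auto)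
  qed
qed simp

text \<open>Everything is deterministic once the start color is known: each hole is entered with a
  determined color and left with the color its strand produces.\<close>

lemma traverses_template_unique:
  assumes "traverses (template_io io h) w a b" "traverses (template_io io h') w a b'"
    "\<And>k. Hole k \<in> set w \<Longrightarrow> crosses io (f k) (h k)"
    "\<And>k. Hole k \<in> set w \<Longrightarrow> crosses io (f k) (h' k)"
  shows "\<forall>k. Hole k \<in> set w \<longrightarrow> h k = h' k"
  using assms
proof (induction w arbitrary: a)
  case (Cons s w)
  have IH: "traverses (template_io io h) w a b \<Longrightarrow> traverses (template_io io h') w a b' \<Longrightarrow>
    \<forall>k. Hole k \<in> set w \<longrightarrow> h k = h' k" for a
    using Cons by simp
  show ?case
  proof (cases s)
    case (Lt l)
    then show ?thesis using Cons.prems(1,2) IH 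
      by (cases "io l") auto
  next
    case (Hole k)
    have eq: "fst (h k) = a" "fst (h' k) = a"
      and tr: "traverses (template_io io h) w (snd (h k)) b" "traverses (template_io io h') w (snd (h' k)) b'"
      using Cons.prems(1,2) Hole by (auto split: prod.splits)
    moreover have "snd (h k) = snd (h' k)"
      using Cons.prems(3,4)[of k] Hole eq by (auto simp: crosses_def intro: traverses_deterministic)
    ultimately show ?thesis using IH[of "snd (h k)"] Hole by (auto simp: prod_eq_iff)
  qed
qed simp

lemma list_all2_fillD:
  assumes "list_all2 (\<lambda>w a. a \<in> closings io (fill_word f w)) T hs"
    "\<And>k. length (filter (\<lambda>s. s = Hole k) (concat T)) \<le> 1"
  shows "\<exists>h. list_all2 (\<lambda>w a. a \<in> closings (template_io io h) w) T hs \<and>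
    (\<forall>k. Hole k \<in> set (concat T) \<longrightarrow> crosses io (f k) (h k))"
  using assms
proof (induction T arbitrary: hs)
  case (Cons w T)
  then obtain a hs' where hs: "hs = a # hs'" "traverses io (fill_word f w) a a"
    "list_all2 (\<lambda>w a. a \<in> closings io (fill_word f w)) T hs'"
    by (auto simp: list_all2_Cons1 closings_def)
  have le: "length (filter (\<lambda>s. s = Hole k) w) \<le> 1" "length (filter (\<lambda>s. s = Hole k) (concat T)) \<le> 1"
    and fresh: "Hole k \<in> set w \<Longrightarrow> Hole k \<notin> set (concat T)" for k
  proof -
    have "length (filter (\<lambda>s. s = Hole k) w) + length (filter (\<lambda>s. s = Hole k) (concat T)) \<le> 1"
      using Cons.prems(2)[of k] by simp
    then show "length (filter (\<lambda>s. s = Hole k) w) \<le> 1" "length (filter (\<lambda>s. s = Hole k) (concat T)) \<le> 1"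
      by linarith+
    have *: "length (filter (\<lambda>s. s = Hole k) u) > 0" if "Hole k \<in> set u" for u
      using that by (auto simp: filter_empty_conv)
    show "Hole k \<notin> set (concat T)" if "Hole k \<in> set w"
      using *[OF that] *[of "concat T"] 
        \<open>length (filter (\<lambda>s. s = Hole k) w) + length (filter (\<lambda>s. s = Hole k) (concat T)) \<le> 1\<close>
      by linarith
  qed
  obtain h1 where h1: "traverses (template_io io h1) w a a" 
    "\<And>k. Hole k \<in> set w \<Longrightarrow> crosses io (f k) (h1 k)"
    using traverses_fill_wordD[OF hs(2) le(1)] by blast
  obtain h2 where h2: "list_all2 (\<lambda>w a. a \<in> closings (template_io io h2) w) T hs'"
    "\<And>k. Hole k \<in> set (concat T) \<Longrightarrow> crosses io (f k) (h2 k)"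
    using Cons.IH[OF hs(3) le(2)] by blast
  \<comment> \<open>No hole lies in two components, so the two partial assignments do not
    compete.\<close>
  define h where "h = (\<lambda>k. if Hole k \<in> set w then h1 k else h2 k)"
  have "traverses (template_io io h) w a a"
    using h1(1) by (rule traverses_cong[THEN iffD1, rotated])
      (auto simp: template_io_def h_def split: tsym.splits)
  moreover have "list_all2 (\<lambda>w a. a \<in> closings (template_io io h) w) T hs'"
    using h2(1)
  proof (rule list.rel_mono_strong)
    fix u b assume u: "u \<in> set T" and b: "b \<in> closings (template_io io h2) u"
    have "Hole k \<notin> set w" if "Hole k \<in> set u" for k using fresh[of k] that u by auto
    then have "traverses (template_io io h2) u b b \<longleftrightarrow> traverses (template_io io h) u b b"
      by (intro traverses_cong) (auto simp: template_io_def h_def split: tsym.splits)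
    then show "b \<in> closings (template_io io h) u" using b by (simp add: closings_def)
  qed
  moreover have "crosses io (f k) (h k)" if "Hole k \<in> set (concat (w # T))" for k
    using that h1(2)[of k] h2(2)[of k] by (auto simp: h_def)
  ultimately show ?case using hs(1) by (intro exI[of _ h]) (auto simp: closings_def)
qed simp

lemma holes_ok_iff:
  assumes "holes_ok n T" shows "Hole k \<in> set (concat T) \<longleftrightarrow> k < n"
proof -
  have "length (filter (\<lambda>s. s = Hole k) (concat T)) = (if k < n then 1 else 0)"
    using assms by (simp add: holes_ok_def)
  moreover have "Hole k \<in> set (concat T) \<longleftrightarrow> filter (\<lambda>s. s = Hole k) (concat T) \<noteq> []"
    by (auto simp: filter_empty_conv)
  ultimately show ?thesis by (auto split: if_splits)
qed

text \<open>The closings of the filled diagram are sorted by the end colors \<open>h\<close> that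
  they induce on the inserted strands. For fixed \<open>h\<close> the template alone decides which
  base colors close up.\<close>

lemma prod_card_closings_fill:
  fixes io :: "letter \<Rightarrow> ('s::finite \<times> 's) option"
  assumes "holes_ok n T"
  shows "(\<Prod>w\<leftarrow>fill T f. card (closings io w)) =
    (\<Sum>h | h \<in> {..<n} \<rightarrow>\<^sub>E UNIV \<and> (\<forall>k<n. crosses io (f k) (h k)). \<Prod>w\<leftarrow>T. card (closings (template_io io h) w))"
proof -
  let ?H = "{h \<in> {..<n} \<rightarrow>\<^sub>E UNIV. \<forall>k<n. crosses io (f k) (h k)}"
  let ?X = "\<lambda>h. {hs. list_all2 (\<lambda>w a. a \<in> closings (template_io io h) w) T hs}"
  let ?Y = "{hs. list_all2 (\<lambda>w a. a \<in> closings io (fill_word f w)) T hs}"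
  note hole = holes_ok_iff[OF assms]
  have le: "length (filter (\<lambda>s. s = Hole k) (concat T)) \<le> 1" for k
    using assms by (simp add: holes_ok_def)
  have finH: "finite ?H"
    by (rule finite_subset[of _ "{..<n} \<rightarrow>\<^sub>E UNIV"]) (auto intro: finite_PiE)
  have finX: "finite (?X h)" for h
    by (rule finite_subset[OF _ finite_lists_length_eq[of UNIV "length T"]]) (auto simp: list_all2_conv_all_nth)
  have "(\<Prod>w\<leftarrow>fill T f. card (closings io w)) = card ?Y"
    unfolding fill_eq card_list_all2 by (simp add: comp_def)
  also have "?Y = snd ` Sigma ?H ?X"
  proof (intro equalityI subsetI)
    fix hs assume "hs \<in> ?Y"
    then obtain h where h: "list_all2 (\<lambda>w a. a \<in> closings (template_io io h) w) T hs"
      "\<forall>k<n. crosses io (f k) (h k)"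
      using list_all2_fillD[of io f T hs] le unfolding hole by auto
    \<comment> \<open>Only extensional \<open>h\<close> are summed over; the values beyond the
      \<open>n\<close> holes are normalized away.\<close>
    have "list_all2 (\<lambda>w a. a \<in> closings (template_io io (restrict h {..<n})) w) T hs"
      using h(1)
    proof (rule list.rel_mono_strong)
      fix u b assume u: "u \<in> set T" and b: "b \<in> closings (template_io io h) u"
      have "k < n" if "Hole k \<in> set u" for k using hole[of k] that u by auto
      then have "traverses (template_io io h) u b b \<longleftrightarrow> traverses (template_io io (restrict h {..<n})) u b b"
        by (intro traverses_cong) (auto simp: template_io_def split: tsym.splits)
      then show "b \<in> closings (template_io io (restrict h {..<n})) u" using b by (simp add: closings_def)
    qed
    then have "(restrict h {..<n}, hs) \<in> Sigma ?H ?X" using h(2) by auto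
    then show "hs \<in> snd ` Sigma ?H ?X" by (rule image_eqI[rotated]) simp
  next
    fix hs assume "hs \<in> snd ` Sigma ?H ?X"
    then obtain h where h: "\<forall>k<n. crosses io (f k) (h k)"
      "list_all2 (\<lambda>w a. a \<in> closings (template_io io h) w) T hs" by auto
    have "list_all2 (\<lambda>w a. a \<in> closings io (fill_word f w)) T hs"
      using h(2)
    proof (rule list.rel_mono_strong)
      fix u b assume u: "u \<in> set T" and b: "b \<in> closings (template_io io h) u"
      have "k < n" if "Hole k \<in> set u" for k using hole[of k] that u by auto
      then show "b \<in> closings io (fill_word f u)"
        using b h(1) traverses_fill_wordI[of io h u b b f] by (auto simp: closings_def)
    qed
    then show "hs \<in> ?Y" by simp
  qed
  \<comment> \<open>Forgetting \<open>h\<close> loses nothing, because the base colors determine it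
    on every hole.\<close>
  also have "card (snd ` Sigma ?H ?X) = card (Sigma ?H ?X)"
  proof (rule card_image, rule inj_onI)
    fix x y assume xy: "x \<in> Sigma ?H ?X" "y \<in> Sigma ?H ?X" "snd x = snd y"
    obtain h hs h' where eq: "x = (h, hs)" "y = (h', hs)" using xy(3) by (metis surjective_pairing)
    have "h k = h' k" if "k < n" for k
    proof -
      have "Hole k \<in> set (concat T)" using hole[of k] that by blast
      then obtain w where w: "w \<in> set T" "Hole k \<in> set w" by auto
      then obtain i where i: "i < length T" "w = T ! i" by (auto simp: in_set_conv_nth)
      have "traverses (template_io io h) w (hs ! i) (hs ! i)" "traverses (template_io io h') w (hs ! i) (hs ! i)"
        using xy(1,2) i by (auto simp: eq closings_def list_all2_conv_all_nth)
      moreover have "crosses io (f j) (h j)" "crosses io (f j) (h' j)" if "Hole j \<in> set w" for j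
        using xy(1,2) hole[of j] that w by (auto simp: eq)
      ultimately show ?thesis
        using traverses_template_unique[of io h w "hs ! i" "hs ! i" h' "hs ! i" f] w by blast
    qed
    moreover have "h \<in> extensional {..<n}" "h' \<in> extensional {..<n}"
      using xy(1,2) by (auto simp: eq PiE_def)
    ultimately have "h = h'" by (intro extensionalityI) auto
    then show "x = y" by (simp add: eq)
  qed
  also have "card (Sigma ?H ?X) = (\<Sum>h\<in>?H. card (?X h))"
    by (rule card_SigmaI) (use finH finX in auto)
  finally show ?thesis by (simp add: card_list_all2)
qed

section \<open>Factorization of the state-sum into outer and local parts\<close>

lemma sum_PiE_Un:
  assumes "A \<inter> B = {}"
  shows "(\<Sum>g \<in> (A \<union> B) \<rightarrow>\<^sub>E UNIV. F (restrict g A) (restrict g B)) =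
    (\<Sum>g0 \<in> A \<rightarrow>\<^sub>E UNIV. \<Sum>g1 \<in> B \<rightarrow>\<^sub>E UNIV. F g0 g1)"
  unfolding sum.cartesian_product
  by (rule sum.reindex_bij_witness[where j = "\<lambda>g. (restrict g A, restrict g B)"
        and i = "\<lambda>(g0, g1) x. if x \<in> A then g0 x else g1 x"])
    (use assms in \<open>auto simp: fun_eq_iff PiE_def extensional_def restrict_def\<close>)

lemma gweight_restrict: "K \<subseteq> L \<Longrightarrow> gweight \<phi> K (restrict g L) = gweight \<phi> K g"
  unfolding gweight_def by (rule sum.cong) auto

lemma traverses_strand_io_restrict:
  assumes "vlabels w \<subseteq> L"
  shows "traverses (strand_io star circ (restrict g L)) w = traverses (strand_io star circ g) w"
  by (intro ext traverses_cong) (use assms in \<open>auto simp: strand_io_def vlabels_def\<close>)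

definition local_labels :: "nat \<Rightarrow> (nat \<Rightarrow> letter list) \<Rightarrow> nat set" where
  "local_labels n f = (\<Union>k<n. vlabels (f k))"

definition local_sum :: "('s \<Rightarrow> 's \<Rightarrow> 's) \<Rightarrow> ('s \<Rightarrow> 's \<Rightarrow> 's) \<Rightarrow> ('s \<Rightarrow> 's \<Rightarrow> 'a::comm_monoid_add)
    \<Rightarrow> nat \<Rightarrow> (nat \<Rightarrow> letter list) \<Rightarrow> (nat \<Rightarrow> 's \<times> 's) \<Rightarrow> 'a \<Rightarrow>\<^sub>0 int" where
  "local_sum star circ \<phi> n f h = (\<Sum>g | g \<in> local_labels n f \<rightarrow>\<^sub>E UNIV \<and>
      (\<forall>k<n. crosses (strand_io star circ g) (f k) (h k)).
     Poly_Mapping.single (gweight \<phi> (local_labels n f) g) 1)"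

definition template_vlabels :: "tsym list list \<Rightarrow> nat set" where
  "template_vlabels T = {lbl a | a. Lt a \<in> set (concat T) \<and> virt a}"

lemma set_fill_word: "set (fill_word f w) = {a. Lt a \<in> set w} \<union> (\<Union>k\<in>{k. Hole k \<in> set w}. set (f k))"
proof (induction w)
  case (Cons s w) then show ?case by (cases s) auto
qed simp

lemma vlabels_fill:
  assumes "holes_ok n T"
  shows "vlabels (concat (fill T f)) = template_vlabels T \<union> local_labels n f"
proof -
  have "set (concat (fill T f)) = {a. Lt a \<in> set (concat T)} \<union> (\<Union>k\<in>{k. Hole k \<in> set (concat T)}. set (f k))"
    by (auto simp: fill_eq set_fill_word)
  then show ?thesis
    unfolding holes_ok_iff[OF assms] vlabels_def template_vlabels_def local_labels_def by auto
qed

text \<open>Outer and local labels are disjoint, so a coloring is an independent choice on each,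
  coupled only through \<open>h\<close>. The weight is additive over the labels, and
  \<open>single\<close> turns this sum into a product in the group ring.\<close>

lemma statesum_fill:
  fixes star circ :: "'s::finite \<Rightarrow> 's \<Rightarrow> 's" and \<phi> :: "'s \<Rightarrow> 's \<Rightarrow> 'a::comm_monoid_add"
  assumes wf: "wf_diagram (fill T f)" and ok: "holes_ok n T"
    and fresh: "local_labels n f \<inter> tlabels T = {}"
  shows "statesum star circ \<phi> (fill T f) =
    (\<Sum>g0 \<in> template_vlabels T \<rightarrow>\<^sub>E UNIV. \<Sum>h \<in> {..<n} \<rightarrow>\<^sub>E UNIV.
       Poly_Mapping.single (gweight \<phi> (template_vlabels T) g0)
         (int (\<Prod>w\<leftarrow>T. card (closings (template_io (strand_io star circ g0) h) w)))
       * local_sum star circ \<phi> n f h)"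
proof -
  let ?L0 = "template_vlabels T" and ?L1 = "local_labels n f"
  let ?io = "strand_io star circ"
  let ?H = "{..<n} \<rightarrow>\<^sub>E (UNIV :: ('s \<times> 's) set)"
  let ?M = "\<lambda>g h. int (\<Prod>w\<leftarrow>T. card (closings (template_io (?io g) h) w))"
  let ?ok = "\<lambda>g h. \<forall>k<n. crosses (?io g) (f k) (h k)"
  \<comment> \<open>The two colorings are separate arguments so that the sum over their union
    splits. The \<open>if\<close> keeps the range of \<open>h\<close> independent of the coloring,
    which allows the sums to be swapped.\<close>
  define F where "F g0 g1 = (\<Sum>h\<in>?H. if ?ok g1 h
    then Poly_Mapping.single (gweight \<phi> ?L0 g0) (?M g0 h) * Poly_Mapping.single (gweight \<phi> ?L1 g1) 1 else 0)" for g0 g1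
  have disj: "?L0 \<inter> ?L1 = {}" using fresh by (auto simp: template_vlabels_def tlabels_def)
  have fin: "finite ?H" "finite ?L1" "finite ?L0"
    using finite_vlabels[of "concat (fill T f)"]
    by (auto intro: finite_PiE simp: vlabels_fill[OF ok] simp del: finite_vlabels)
  have M: "?M (restrict g ?L0) h = ?M g h" for g h
  proof -
    have "template_io (?io (restrict g ?L0)) h s = template_io (?io g) h s" if "w \<in> set T" "s \<in> set w" for w s
      using that by (auto simp: template_io_def strand_io_def template_vlabels_def split: tsym.splits)
    then have "closings (template_io (?io (restrict g ?L0)) h) w = closings (template_io (?io g) h) w" if "w \<in> set T" for w
      unfolding closings_def using that by (intro Collect_cong traverses_cong) auto
    then show ?thesis by (simp cong: map_cong)
  qed
  have ok_restrict: "?ok (restrict g ?L1) h \<longleftrightarrow> ?ok g h" for g h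
  proof -
    have "vlabels (f k) \<subseteq> ?L1" if "k < n" for k using that by (auto simp: local_labels_def)
    then show ?thesis by (auto simp: crosses_def traverses_strand_io_restrict)
  qed
  have "statesum star circ \<phi> (fill T f) = (\<Sum>g \<in> (?L0 \<union> ?L1) \<rightarrow>\<^sub>E UNIV.
      Poly_Mapping.single (gweight \<phi> (?L0 \<union> ?L1) g) (int (\<Prod>w\<leftarrow>fill T f. card (closings (?io g) w))))"
    unfolding statesum_crossing_colorings[OF wf] vlabels_fill[OF ok] ..
  also have "\<dots> = (\<Sum>g \<in> (?L0 \<union> ?L1) \<rightarrow>\<^sub>E UNIV. F (restrict g ?L0) (restrict g ?L1))"
  proof (rule sum.cong[OF refl])
    fix g
    have W: "gweight \<phi> (?L0 \<union> ?L1) g = gweight \<phi> ?L0 g + gweight \<phi> ?L1 g"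
      unfolding gweight_def by (rule sum.union_disjoint) (use fin disj in auto)
    have "Poly_Mapping.single (gweight \<phi> (?L0 \<union> ?L1) g) (int (\<Prod>w\<leftarrow>fill T f. card (closings (?io g) w)))
      = (\<Sum>h | h \<in> ?H \<and> ?ok g h. Poly_Mapping.single (gweight \<phi> ?L0 g + gweight \<phi> ?L1 g) (?M g h))"
      unfolding prod_card_closings_fill[OF ok] W by (simp add: single_sum_const)
    also have "\<dots> = (\<Sum>h\<in>?H. if ?ok g h
       then Poly_Mapping.single (gweight \<phi> ?L0 g) (?M g h) * Poly_Mapping.single (gweight \<phi> ?L1 g) 1 else 0)"
      by (simp add: sum.inter_filter[OF fin(1)] mult_single cong: if_cong)
    also have "\<dots> = F (restrict g ?L0) (restrict g ?L1)"
      unfolding F_def M ok_restrict by (simp add: gweight_restrict cong: if_cong)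
    finally show "Poly_Mapping.single (gweight \<phi> (?L0 \<union> ?L1) g) (int (\<Prod>w\<leftarrow>fill T f. card (closings (?io g) w)))
       = F (restrict g ?L0) (restrict g ?L1)" .
  qed
  also have "\<dots> = (\<Sum>g0 \<in> ?L0 \<rightarrow>\<^sub>E UNIV. \<Sum>g1 \<in> ?L1 \<rightarrow>\<^sub>E UNIV. F g0 g1)"
    by (rule sum_PiE_Un[OF disj])
  also have "\<dots> = (\<Sum>g0 \<in> ?L0 \<rightarrow>\<^sub>E UNIV. \<Sum>h \<in> ?H.
      Poly_Mapping.single (gweight \<phi> ?L0 g0) (?M g0 h) * local_sum star circ \<phi> n f h)"
  proof (rule sum.cong[OF refl])
    fix g0
    have fin1: "finite (?L1 \<rightarrow>\<^sub>E (UNIV :: (bool \<Rightarrow> 's) set))" using fin by (auto intro: finite_PiE)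
    show "(\<Sum>g1 \<in> ?L1 \<rightarrow>\<^sub>E UNIV. F g0 g1) = (\<Sum>h \<in> ?H.
        Poly_Mapping.single (gweight \<phi> ?L0 g0) (?M g0 h) * local_sum star circ \<phi> n f h)"
      unfolding F_def local_sum_def
      by (subst sum.swap) (simp add: sum_distrib_left sum.inter_filter[OF fin1] if_distrib cong: if_cong)
  qed
  finally show ?thesis .
qed

text \<open>The outer factor depends only on \<open>T\<close> and \<open>h\<close>, so a move need
  only be checked on its local sums.\<close>

lemma statesum_fill_cong:
  fixes star circ :: "'s::finite \<Rightarrow> 's \<Rightarrow> 's" and \<phi> :: "'s \<Rightarrow> 's \<Rightarrow> 'a::comm_monoid_add"
  assumes "wf_diagram (fill T f)" "wf_diagram (fill T f')" "holes_ok n T"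
    "local_labels n f \<inter> tlabels T = {}" "local_labels n f' \<inter> tlabels T = {}"
    "\<And>h. local_sum star circ \<phi> n f h = local_sum star circ \<phi> n f' h"
  shows "statesum star circ \<phi> (fill T f) = statesum star circ \<phi> (fill T f')"
  unfolding statesum_fill[OF assms(1,3,4)] statesum_fill[OF assms(2,3,5)] assms(6) ..

text \<open>\<open>Q\<close> is the condition on the end colors for an inner coloring to exist, and
  \<open>G\<close> the only candidate; the sum then has at most one term. \<open>G\<close> is pinned
  down on the local labels only, so its values elsewhere are free.\<close>

lemma local_sum_unique:
  fixes star circ :: "'s::finite \<Rightarrow> 's \<Rightarrow> 's" and \<phi> :: "'s \<Rightarrow> 's \<Rightarrow> 'a::comm_monoid_add"
  assumes unique: "\<And>g. \<forall>k<n. crosses (strand_io star circ g) (f k) (h k) \<Longrightarrow> Q"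
      "\<And>g c. \<forall>k<n. crosses (strand_io star circ g) (f k) (h k) \<Longrightarrow> c \<in> local_labels n f \<Longrightarrow> g c = G c"
    and ex: "Q \<Longrightarrow> \<forall>k<n. crosses (strand_io star circ G) (f k) (h k)"
  shows "local_sum star circ \<phi> n f h =
    (if Q then Poly_Mapping.single (gweight \<phi> (local_labels n f) G) 1 else 0)"
proof -
  let ?L = "local_labels n f"
  have "vlabels (f k) \<subseteq> ?L" if "k < n" for k using that by (auto simp: local_labels_def)
  then have "\<forall>k<n. crosses (strand_io star circ (restrict G ?L)) (f k) (h k)" if Q
    using ex[OF that] by (auto simp: crosses_def traverses_strand_io_restrict)
  moreover have "g = restrict G ?L" if "g \<in> ?L \<rightarrow>\<^sub>E UNIV" "\<forall>k<n. crosses (strand_io star circ g) (f k) (h k)" for g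
    by (rule extensionalityI[of _ ?L]) (use that unique(2) in \<open>auto simp: PiE_def\<close>)
  ultimately have "{g. g \<in> ?L \<rightarrow>\<^sub>E UNIV \<and> (\<forall>k<n. crosses (strand_io star circ g) (f k) (h k))} =
    (if Q then {restrict G ?L} else {})"
    using unique(1) by (cases Q) (auto simp del: not_all)
  then show ?thesis by (auto simp: local_sum_def gweight_restrict)
qed

lemma traverses_flat:
  assumes "vlabels w = {}"
  shows "traverses (strand_io star circ g) w a b \<longleftrightarrow> a = b"
  using assms by (induction w) (auto simp: strand_io_def split: if_splits)

text \<open>Flat strands carry their color through unchanged, and the empty inner coloring is the
  only one. This covers empty strands as well.\<close>

lemma local_sum_flat:
  assumes "local_labels n f = {}"
  shows "local_sum star circ \<phi> n f h =
    (if \<forall>k<n. fst (h k) = snd (h k) then Poly_Mapping.single 0 1 else 0)"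
proof -
  have "vlabels (f k) = {}" if "k < n" for k using assms that by (auto simp: local_labels_def)
  then show ?thesis
    by (auto simp: local_sum_def assms crosses_def traverses_flat gweight_def)
qed

subsection \<open>Weights of a cocycle\<close>

text \<open>\<open>cocycle_VF'\<close> says that \<open>\<phi>\<close> vanishes on the generators of
  C'_2; the other two cocycle conditions are (2) and (3).\<close>

locale vflat_cocycle =
  fixes star circ :: "'s::finite \<Rightarrow> 's \<Rightarrow> 's" and \<phi> :: "'s \<Rightarrow> 's \<Rightarrow> 'a::ab_group_add"
  assumes biquandle: "vflat_biquandle star circ"
    and no_2_torsion: "x + x = 0 \<Longrightarrow> x = (0::'a)"
    and cocycle_VF': "\<phi> a b + \<phi> (circ b a) (star a b) = 0"
    and cocycle_VF: "- \<phi> b c + \<phi> (circ b a) (circ c a) + \<phi> (star a b) c - \<phi> a (circ c b)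
                 - \<phi> (star a c) (star b c) + \<phi> a b = 0"
    and cocycle_SF: "- \<phi> b c + \<phi> b (circ c a) + \<phi> a c - \<phi> a (circ c b) = 0"
begin

abbreviation A where "A \<equiv> act star circ"

lemma star_circ_simps:
  "star x (star a b) = star x a" "star x (circ a b) = star x a"
  "circ x (star a b) = circ x a" "circ x (circ a b) = circ x a"
  "circ (star x a) a = x" "star (circ x a) a = x"
  using biquandle unfolding vflat_biquandle_def by metis+

lemma star_circ_comm:
  "star (star x b) a = star (star x a) b" "circ (circ x b) a = circ (circ x a) b"
  "star (circ x b) a = circ (star x a) b"
  using biquandle unfolding vflat_biquandle_def by metis+

text \<open>The operator of a color depends only on its orbit. The equation is between functions, so
  that it rewrites the acting color whatever is acted upon.\<close>

lemma act_class: "A s (A t c b) = A s b"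
  by (intro ext) (auto simp: act_def star_circ_simps)

lemma act_comm: "A s b (A t c a) = A t c (A s b a)"
  by (auto simp: act_def star_circ_comm)

lemma act_cancel: "A (\<not> s) b (A s b a) = a" "A s b (A (\<not> s) b a) = a"
  by (auto simp: act_def star_circ_simps)

lemma act_cancel': "A (\<not> s) b (A t c (A s b a)) = A t c a" "A s b (A t c (A (\<not> s) b a)) = A t c a"
  by (simp_all add: act_comm[of _ b t c] act_cancel)

text \<open>The weight of a virtual crossing seen from one of its strands, which lies on
  side s and brings the color u, while the other strand brings the color v.\<close>

definition wt :: "bool \<Rightarrow> 's \<Rightarrow> 's \<Rightarrow> 'a" where
  "wt s u v = (if s then \<phi> u v else \<phi> v u)"

lemma wt_not: "wt (\<not> s) u v = wt s v u"
  by (simp add: wt_def)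

text \<open>Condition (1) in side-independent form: in a bigon of parallel strands the colors
  leaving one crossing enter the next with the sides exchanged, and the two weights are
  opposite.\<close>

lemma wt_out: "wt (\<not> s) (A s v u) (A (\<not> s) u v) = - wt s u v"
  using cocycle_VF'[of u v] cocycle_VF'[of v u]
  by (auto simp: wt_def act_def eq_neg_iff_add_eq_0 add.commute)

text \<open>Condition (2) for three parallel strands. Reading the strands from the other side
  exchanges the roles of \<open>a\<close> and \<open>c\<close>.\<close>

lemma wt_braid:
  "wt s a b + wt s (A s b a) c + wt s (A (\<not> s) a b) (A (\<not> s) a c) =
   wt s (A s c a) (A s c b) + wt s a (A (\<not> s) b c) + wt s b c"
proof (cases s)
  case True
  then show ?thesis
    using cocycle_VF[of b c a] by (simp add: wt_def act_def algebra_simps)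
next
  case False
  then show ?thesis
    using cocycle_VF[of b a c] by (simp add: wt_def act_def algebra_simps)
qed

text \<open>A strand of color \<open>u\<close> passes two strands that do not affect each other,
  since their common crossing is flat. Condition (3) is the case where \<open>u\<close> is on the
  right both times; (1) supplies the other sides.\<close>

lemma wt_mixed: "wt p u a + wt q (A p a u) b = wt q u b + wt p (A q b u) a"
proof -
  have FF: "\<phi> a u + \<phi> b (circ u a) = \<phi> b u + \<phi> a (circ u b)" for a b u
    using cocycle_SF[of b u a] by (simp add: algebra_simps)
  have neg: "\<phi> u v = - \<phi> (circ v u) (star u v)" for u v
    using cocycle_VF'[of u v] by (simp add: eq_neg_iff_add_eq_0)
  have star_ba: "circ (star (star u a) b) a = star u b"
    using star_circ_comm(1)[of u a b] by (simp add: star_circ_simps)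
  \<comment> \<open>\<open>FF\<close> is applied to the strand run backwards: it starts with the
    color \<open>u\<close> has after both crossings, and \<open>neg\<close> returns each weight to
    the incoming colors.\<close>
  have TT: "\<phi> u a + \<phi> (star u a) b = \<phi> u b + \<phi> (star u b) a"
    using FF[of "circ a u" "star (star u a) b" "circ b u"] star_circ_comm(1)[of u b a]
    by (simp add: star_ba neg[of u a] neg[of "star u a" b] neg[of u b] neg[of "star u b" a]
        star_circ_simps star_circ_comm algebra_simps)
  \<comment> \<open>Here only the crossing with \<open>a\<close> is read at its outgoing
    colors.\<close>
  have TF: "\<phi> u a + \<phi> b (star u a) = \<phi> b u + \<phi> (circ u b) a" for u a b
    using FF[of "circ a u" "star u a" b]
    by (simp add: neg[of u a] neg[of "circ u b" a] star_circ_simps star_circ_comm algebra_simps)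
  show ?thesis
    using FF[of a u b] TT TF[of u a b] TF[of u b a]
    by (cases p; cases q) (simp_all add: wt_def act_def algebra_simps)
qed

definition actv :: "bool \<Rightarrow> bool \<Rightarrow> 's \<Rightarrow> 's \<Rightarrow> 's" where
  "actv v s b a = (if v then A s b a else a)"

lemma actv_class: "actv v s (actv w t c b) = actv v s b"
  by (auto simp: actv_def act_class fun_eq_iff)

lemma actv_comm: "actv v s b (actv w t c a) = actv w t c (actv v s b a)"
  by (auto simp: actv_def act_comm)

lemma traverses_Pass:
  "traverses (strand_io star circ g) (Pass c v s # w) a b \<longleftrightarrow>
    (v \<longrightarrow> g c s = a) \<and> traverses (strand_io star circ g) w (actv v s (g c (\<not> s)) a) b"
  by (auto simp: strand_io_def actv_def)

section \<open>Weights of the triangle in Omega3\<close>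

text \<open>The strands enter with colors \<open>a\<close>, \<open>b\<close>, \<open>c\<close>. Each
  weight is seen from the lower-numbered strand, and a color is changed first if the other crossing
  on its strand comes earlier. The acting colors are always entering colors, which
  \<open>actv_class\<close> justifies.\<close>

definition r3_weight :: "bool \<Rightarrow> bool \<Rightarrow> bool \<Rightarrow> bool \<Rightarrow> bool \<Rightarrow> bool \<Rightarrow> bool \<Rightarrow> bool \<Rightarrow> bool
    \<Rightarrow> 's \<Rightarrow> 's \<Rightarrow> 's \<Rightarrow> 'a" where
  "r3_weight vx vy vz o1 o2 o3 p q r a b c =
     (if vx then wt p (if o1 then a else actv vy q c a) (if o2 then b else actv vz r c b) else 0) +
     (if vy then wt q (if o1 then actv vx p b a else a) (if o3 then c else actv vz (\<not> r) b c) else 0) +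
     (if vz then wt r (if o2 then actv vx (\<not> p) a b else b) (if o3 then actv vy (\<not> q) a c else c) else 0)"

lemma r3_virtual_TTT:
  "r3_weight True True True True True True p p p a b c =
   r3_weight True True True False False False p p p a b c"
  unfolding r3_weight_def actv_def using wt_braid[of p a b c] by simp

text \<open>Strand 0 runs against the pattern of \<open>wt_braid\<close>. Run backwards it starts
  with its final color \<open>?d\<close> and meets the others with the colors \<open>?b\<close>,
  \<open>?c\<close> they have after crossing it. By \<open>wt_out\<close> its four weights become
  negatives of those in \<open>wt_braid\<close> and change sides of the equation.\<close>

lemma r3_virtual_FTT:
  "r3_weight True True True False True True (\<not> r) (\<not> r) r a b c =
   r3_weight True True True True False False (\<not> r) (\<not> r) r a b c"
proof -
  let ?d = "A (\<not> r) b (A (\<not> r) c a)" and ?b = "A r a b" and ?c = "A r a c"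
  have 1: "wt (\<not> r) (A (\<not> r) c a) b = - wt r ?d ?b"
    using wt_out[of "\<not> r" b "A (\<not> r) c a"] by (simp add: act_class)
  have 2: "wt (\<not> r) a c = - wt r (A (\<not> r) c a) ?c"
    using wt_out[of "\<not> r" c a] by (simp add: act_class)
  have 3: "wt (\<not> r) a (A r c b) = - wt r (A (\<not> r) b a) (A r c ?b)"
    using wt_out[of "\<not> r" "A r c b" a] by (simp add: act_class act_comm[of r a r c])
  have 4: "wt (\<not> r) (A (\<not> r) b a) (A (\<not> r) b c) = - wt r ?d (A (\<not> r) b ?c)"
    using wt_out[of "\<not> r" "A (\<not> r) b c" "A (\<not> r) b a"]
    by (simp add: act_class act_comm[of r a "\<not> r" b] act_comm[of "\<not> r" c "\<not> r" b])
  have "wt r ?d ?b + wt r (A (\<not> r) c a) ?c + wt r b c =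
    wt r (A (\<not> r) b a) (A r c ?b) + wt r ?d (A (\<not> r) b ?c) + wt r ?b ?c"
    using wt_braid[of r ?d ?b ?c] by (simp add: act_class act_cancel act_cancel')
  then show ?thesis
    by (simp add: r3_weight_def actv_def 1 2 3 4 algebra_simps)
qed

text \<open>The same argument with strand 1 run backwards: \<open>?d\<close> is its final color,
  \<open>?a\<close> and \<open>?c\<close> are the colors of the others after meeting it.\<close>

lemma r3_virtual_TFT:
  "r3_weight True True True True False True (\<not> s) s (\<not> s) a b c =
   r3_weight True True True False True False (\<not> s) s (\<not> s) a b c"
proof -
  let ?a = "A (\<not> s) b a" and ?d = "A s a (A (\<not> s) c b)" and ?c = "A s b c"
  have 1: "wt (\<not> s) a (A (\<not> s) c b) = - wt s ?a ?d"
    using wt_out[of "\<not> s" "A (\<not> s) c b" a] by (simp add: act_class)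
  have 2: "wt (\<not> s) b (A (\<not> s) a c) = - wt s (A (\<not> s) c b) (A (\<not> s) a ?c)"
    using wt_out[of "\<not> s" "A (\<not> s) a c" b] by (simp add: act_class act_comm[of s b "\<not> s" a])
  have 3: "wt (\<not> s) (A s c a) b = - wt s (A s c ?a) (A s a b)"
    using wt_out[of "\<not> s" b "A s c a"] by (simp add: act_class act_comm[of "\<not> s" b s c])
  have 4: "wt (\<not> s) (A s a b) c = - wt s ?d ?c"
    using wt_out[of "\<not> s" c "A s a b"] by (simp add: act_class act_comm[of "\<not> s" c s a])
  have "wt s ?a ?d + wt s a ?c + wt s (A (\<not> s) c b) (A (\<not> s) a ?c) =
    wt s (A s c ?a) (A s a b) + wt s ?a c + wt s ?d ?c"
    using wt_braid[of s ?a ?d ?c] by (simp add: act_class act_cancel act_cancel')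
  then show ?thesis
    by (simp add: r3_weight_def actv_def 1 2 3 4 algebra_simps)
qed

text \<open>The same argument with strand 2 run backwards.\<close>

lemma r3_virtual_TTF:
  "r3_weight True True True True True False s (\<not> s) (\<not> s) a b c =
   r3_weight True True True False False True s (\<not> s) (\<not> s) a b c"
proof -
  let ?a = "A (\<not> s) c a" and ?b = "A (\<not> s) c b" and ?d = "A s b (A s a c)"
  have 1: "wt (\<not> s) (A s b a) (A s b c) = - wt s (A s b ?a) ?d"
    using wt_out[of "\<not> s" "A s b c" "A s b a"]
    by (simp add: act_class act_comm[of "\<not> s" c s b] act_comm[of s a s b])
  have 2: "wt (\<not> s) (A (\<not> s) a b) c = - wt s (A (\<not> s) a ?b) (A s b c)"
    using wt_out[of "\<not> s" c "A (\<not> s) a b"] by (simp add: act_class act_comm[of "\<not> s" c "\<not> s" a])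
  have 3: "wt (\<not> s) a c = - wt s ?a (A s a c)"
    using wt_out[of "\<not> s" c a] by (simp add: act_class)
  have 4: "wt (\<not> s) b (A s a c) = - wt s ?b ?d"
    using wt_out[of "\<not> s" "A s a c" b] by (simp add: act_class)
  have "wt s ?a ?b + wt s (A s b ?a) ?d + wt s (A (\<not> s) a ?b) (A s b c) =
    wt s a b + wt s ?a (A s a c) + wt s ?b ?d"
    using wt_braid[of s ?a ?b ?d] by (simp add: act_class act_cancel act_cancel')
  then show ?thesis
    by (simp add: r3_weight_def actv_def 1 2 3 4 algebra_simps)
qed

text \<open>The side conditions express \<open>q\<close> and \<open>r\<close> through
  \<open>p\<close>. The eight order patterns form four complementary pairs, each settled by one of
  the preceding lemmas read in one of its two directions.\<close>

lemma r3_virtual: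
  assumes "(p \<noteq> q) = (o2 \<noteq> o3)" "(p \<noteq> r) = (o1 \<noteq> o3)"
  shows "r3_weight True True True o1 o2 o3 p q r a b c =
    r3_weight True True True (\<not> o1) (\<not> o2) (\<not> o3) p q r a b c"
proof -
  have q: "q = (if o2 = o3 then p else \<not> p)" and r: "r = (if o1 = o3 then p else \<not> p)"
    using assms by auto
  show ?thesis
    unfolding q r
    using r3_virtual_TTT[of p a b c] r3_virtual_FTT[of "\<not> p" a b c]
      r3_virtual_TFT[of "\<not> p" a b c] r3_virtual_TTF[of p a b c]
    by (cases o1; cases o2; cases o3) (simp_all only: not_not simp_thms if_True if_False)
qed

text \<open>The two virtual crossings share a strand: strand 0, 1 or 2 when \<open>z\<close>,
  \<open>y\<close> or \<open>x\<close> is flat. That strand plays the role of \<open>u\<close> in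
  \<open>wt_mixed\<close>, and \<open>wt_not\<close> changes the viewpoint to it where
  necessary.\<close>

lemma r3_mixed:
  "r3_weight True True False o1 o2 o3 p q r a b c =
     r3_weight True True False (\<not> o1) (\<not> o2) (\<not> o3) p q r a b c"
  "r3_weight True False True o1 o2 o3 p q r a b c =
     r3_weight True False True (\<not> o1) (\<not> o2) (\<not> o3) p q r a b c"
  "r3_weight False True True o1 o2 o3 p q r a b c =
     r3_weight False True True (\<not> o1) (\<not> o2) (\<not> o3) p q r a b c"
proof -
  have z: "wt p a b + wt q (A p b a) c = wt p (A q c a) b + wt q a c"
    by (subst wt_mixed) (rule add.commute)
  show "r3_weight True True False o1 o2 o3 p q r a b c =
     r3_weight True True False (\<not> o1) (\<not> o2) (\<not> o3) p q r a b c"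
    by (cases o1) (simp_all add: r3_weight_def actv_def z)
  have y: "wt p a b + wt r (A (\<not> p) a b) c = wt p a (A r c b) + wt r b c"
    using wt_mixed[of "\<not> p" b a r c] by (simp only: wt_not add.commute)
  show "r3_weight True False True o1 o2 o3 p q r a b c =
     r3_weight True False True (\<not> o1) (\<not> o2) (\<not> o3) p q r a b c"
    by (cases o2) (simp_all add: r3_weight_def actv_def y)
  have x: "wt q a c + wt r b (A (\<not> q) a c) = wt q a (A (\<not> r) b c) + wt r b c"
    using wt_mixed[of "\<not> q" c a "\<not> r" b] by (simp only: wt_not add.commute)
  show "r3_weight False True True o1 o2 o3 p q r a b c =
     r3_weight False True True (\<not> o1) (\<not> o2) (\<not> o3) p q r a b c"
    by (cases o3) (simp_all add: r3_weight_def actv_def x)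
qed

lemma r3_weight_reverse:
  assumes "length (filter Not [vx, vy, vz]) \<in> {0, 1, 3}"
    and "(p \<noteq> q) = (o2 \<noteq> o3)" "(p \<noteq> r) = (o1 \<noteq> o3)"
  shows "r3_weight vx vy vz o1 o2 o3 p q r a b c =
    r3_weight vx vy vz (\<not> o1) (\<not> o2) (\<not> o3) p q r a b c"
proof -
  \<comment> \<open>The patterns left out are those with exactly two flat crossings.\<close>
  consider "vx" "vy" "vz" | "vx" "vy" "\<not> vz" | "vx" "\<not> vy" "vz" | "\<not> vx" "vy" "vz"
    | "\<not> vx" "\<not> vy" "\<not> vz"
    using assms(1) by (auto split: if_splits)
  then show ?thesis
  proof cases
    case 1 then show ?thesis using r3_virtual[OF assms(2,3), of a b c] by simp
  next
    case 2 then show ?thesis using r3_mixed(1)[of o1 o2 o3 p q r a b c] by simp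
  next
    case 3 then show ?thesis using r3_mixed(2)[of o1 o2 o3 p q r a b c] by simp
  next
    case 4 then show ?thesis using r3_mixed(3)[of o1 o2 o3 p q r a b c] by simp
  next
    case 5 then show ?thesis by (simp add: r3_weight_def)
  qed
qed

definition corner :: "bool \<Rightarrow> 's \<Rightarrow> 's \<Rightarrow> bool \<Rightarrow> 's" where
  "corner s u v t = (if t = s then u else v)"

lemma corner_simps [simp]: "corner s u v s = u" "corner s u v (\<not> s) = v" "corner (\<not> s) u v s = v"
  by (auto simp: corner_def)

lemma corner_eqI:
  assumes "h s = u" "h (\<not> s) = v"
  shows "h = corner s u v"
proof
  fix t
  consider "t = s" | "t = (\<not> s)" by blast
  then show "h t = corner s u v t" using assms by cases simp_all
qed

lemma weight_corner: "\<phi> (corner s u v True) (corner s u v False) = wt s u v"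
  by (cases s) (simp_all add: corner_def wt_def)

subsection \<open>Local state-sums of the moves\<close>

text \<open>Both sides of Omega3 thus belong to the same family of words, and one computation of the
  local sum serves for both.\<close>

lemma r3words_rev:
  "rev (r3words x y z vx vy vz o1 o2 o3 p q r k) = r3words x y z vx vy vz (\<not> o1) (\<not> o2) (\<not> o3) p q r k"
  by (simp add: r3words_def)

lemma r3_labels:
  "local_labels 3 (r3words x y z vx vy vz o1 o2 o3 p q r) =
    {c. c = x \<and> vx \<or> c = y \<and> vy \<or> c = z \<and> vz}"
proof -
  have "{..<3::nat} = {0, 1, 2}" by auto
  then have "local_labels 3 (r3words x y z vx vy vz o1 o2 o3 p q r) =
    (if vx then {x} else {}) \<union> (if vy then {y} else {}) \<union> (if vz then {z} else {})"
    by (cases o1; cases o2; cases o3; simp add: local_labels_def r3words_def insert_commute)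
  then show ?thesis by auto
qed

text \<open>The operators commute and see only orbits, so the condition on the end colors is free of
  \<open>o1\<close>, \<open>o2\<close>, \<open>o3\<close>. Only the weight remembers the order of
  the crossings.\<close>

lemma local_sum_r3:
  assumes distinct: "distinct [x, y, z]"
    and h: "h 0 = (a, a')" "h 1 = (b, b')" "h 2 = (c, c')"
  shows "local_sum star circ \<phi> 3 (r3words x y z vx vy vz o1 o2 o3 p q r) h =
    (if a' = actv vx p b (actv vy q c a) \<and> b' = actv vx (\<not> p) a (actv vz r c b)
        \<and> c' = actv vy (\<not> q) a (actv vz (\<not> r) b c)
     then Poly_Mapping.single (r3_weight vx vy vz o1 o2 o3 p q r a b c) 1 else 0)"
proof -
  have all3: "(\<forall>k<3. P k) \<longleftrightarrow> P 0 \<and> P 1 \<and> P (2::nat)" for P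
    by (auto simp: numeral_3_eq_3 numeral_2_eq_2 less_Suc_eq)
  let ?f = "r3words x y z vx vy vz o1 o2 o3 p q r"
  \<comment> \<open>The last branch is meant for \<open>z\<close> and also serves as a default for
    all foreign labels, which are not local.\<close>
  let ?G = "\<lambda>l. if l = x then corner p (if o1 then a else actv vy q c a) (if o2 then b else actv vz r c b)
    else if l = y then corner q (if o1 then actv vx p b a else a) (if o3 then c else actv vz (\<not> r) b c)
    else corner r (if o2 then actv vx (\<not> p) a b else b) (if o3 then actv vy (\<not> q) a c else c)"
  let ?Q = "a' = actv vx p b (actv vy q c a) \<and> b' = actv vx (\<not> p) a (actv vz r c b)
        \<and> c' = actv vy (\<not> q) a (actv vz (\<not> r) b c)"
  have crosses_iff: "(\<forall>k<3. crosses (strand_io star circ g) (?f k) (h k)) \<longleftrightarrow>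
     (if o1 then (vx \<longrightarrow> g x p = a) \<and> (vy \<longrightarrow> g y q = actv vx p (g x (\<not> p)) a)
         \<and> actv vy q (g y (\<not> q)) (actv vx p (g x (\<not> p)) a) = a'
      else (vy \<longrightarrow> g y q = a) \<and> (vx \<longrightarrow> g x p = actv vy q (g y (\<not> q)) a)
         \<and> actv vx p (g x (\<not> p)) (actv vy q (g y (\<not> q)) a) = a') \<and>
     (if o2 then (vx \<longrightarrow> g x (\<not> p) = b) \<and> (vz \<longrightarrow> g z r = actv vx (\<not> p) (g x p) b)
         \<and> actv vz r (g z (\<not> r)) (actv vx (\<not> p) (g x p) b) = b'
      else (vz \<longrightarrow> g z r = b) \<and> (vx \<longrightarrow> g x (\<not> p) = actv vz r (g z (\<not> r)) b)
         \<and> actv vx (\<not> p) (g x p) (actv vz r (g z (\<not> r)) b) = b') \<and>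
     (if o3 then (vy \<longrightarrow> g y (\<not> q) = c) \<and> (vz \<longrightarrow> g z (\<not> r) = actv vy (\<not> q) (g y q) c)
         \<and> actv vz (\<not> r) (g z r) (actv vy (\<not> q) (g y q) c) = c'
      else (vz \<longrightarrow> g z (\<not> r) = c) \<and> (vy \<longrightarrow> g y (\<not> q) = actv vz (\<not> r) (g z r) c)
         \<and> actv vy (\<not> q) (g y q) (actv vz (\<not> r) (g z r) c) = c')" for g
    by (cases o1; cases o2; cases o3; simp add: all3 crosses_def h
        h(2)[unfolded One_nat_def] r3words_def traverses_Pass del: traverses.simps(2))
  have solution: "?Q \<and> (vx \<longrightarrow> g x = ?G x) \<and> (vy \<longrightarrow> g y = ?G y) \<and> (vz \<longrightarrow> g z = ?G z)"
    if g: "\<forall>k<3. crosses (strand_io star circ g) (?f k) (h k)" for g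
  proof -
    note cr = g[unfolded crosses_iff]
    note cr1 = cr[THEN conjunct1] and cr2 = cr[THEN conjunct2, THEN conjunct1]
      and cr3 = cr[THEN conjunct2, THEN conjunct2]
    \<comment> \<open>Each color on a strand is the entering color or its image under one crossing,
      hence acts in the same way.\<close>
    have *: "actv v s e = actv v s d" if "v \<longrightarrow> e = d \<or> (\<exists>w t k. e = actv w t k d)" for v s e d
      using that by (cases v) (auto simp: actv_class, simp add: actv_def fun_eq_iff)
    have cls: "actv vx s (g x p) = actv vx s a" "actv vy s (g y q) = actv vy s a"
      "actv vx s (g x (\<not> p)) = actv vx s b" "actv vz s (g z r) = actv vz s b"
      "actv vy s (g y (\<not> q)) = actv vy s c" "actv vz s (g z (\<not> r)) = actv vz s c" for s
      by (rule *, use cr1 in \<open>cases o1; simp only: if_True if_False; blast\<close>)+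
        (rule *, use cr2 in \<open>cases o2; simp only: if_True if_False; blast\<close>,
         rule *, use cr2 in \<open>cases o2; simp only: if_True if_False; blast\<close>,
         (rule *, use cr3 in \<open>cases o3; simp only: if_True if_False; blast\<close>)+)
    \<comment> \<open>The equations of \<open>cr\<close> may refer to one another in a cycle around
      the triangle. With the entering colors as acting colors they can be solved directly.\<close>
    note cr' = cr1[unfolded cls] cr2[unfolded cls] cr3[unfolded cls]
    have "vx \<longrightarrow> g x = corner p (if o1 then a else actv vy q c a) (if o2 then b else actv vz r c b)"
      "vy \<longrightarrow> g y = corner q (if o1 then actv vx p b a else a) (if o3 then c else actv vz (\<not> r) b c)"
      "vz \<longrightarrow> g z = corner r (if o2 then actv vx (\<not> p) a b else b) (if o3 then actv vy (\<not> q) a c else c)"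
      by (intro impI corner_eqI; use cr' in \<open>simp split: if_splits\<close>)+
    moreover have ?Q
      using cr'
      by (cases o1; cases o2; cases o3) (simp_all add: actv_comm[of vx] actv_comm[of vy _ _ vz])
    ultimately show ?thesis using distinct by auto
  qed
  have "local_sum star circ \<phi> 3 ?f h =
    (if ?Q then Poly_Mapping.single (gweight \<phi> (local_labels 3 ?f) ?G) 1 else 0)"
  proof (rule local_sum_unique)
    show ?Q if "\<forall>k<3. crosses (strand_io star circ g) (?f k) (h k)" for g
      using solution[OF that] by blast
    show "g l = ?G l" if "\<forall>k<3. crosses (strand_io star circ g) (?f k) (h k)" "l \<in> local_labels 3 ?f" for g l
      using solution[OF that(1)] that(2) unfolding r3_labels by blast
    show "\<forall>k<3. crosses (strand_io star circ ?G) (?f k) (h k)" if ?Q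
      unfolding crosses_iff using distinct that
      by (cases o1; cases o2; cases o3) (simp_all add: actv_class actv_comm[of vx] actv_comm[of vy _ _ vz])
  qed
  moreover have "gweight \<phi> (local_labels 3 ?f) ?G = r3_weight vx vy vz o1 o2 o3 p q r a b c"
  proof -
    have "local_labels 3 ?f = (if vx then {x} else {}) \<union> (if vy then {y} else {}) \<union> (if vz then {z} else {})"
      unfolding r3_labels by auto
    then show ?thesis
      using distinct by (auto simp: gweight_def r3_weight_def actv_def weight_corner add.assoc)
  qed
  ultimately show ?thesis by simp
qed

text \<open>The second passage undoes the action of the first, so the kink passes its color on
  unchanged. The colors leaving the crossing are those entering it, exchanged, which makes the
  weight its own negative.\<close>

lemma local_sum_r1:
  "local_sum star circ \<phi> 1 (\<lambda>_. [Pass c v s, Pass c v (\<not> s)]) h = local_sum star circ \<phi> 1 (\<lambda>_. []) h"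
proof (cases v)
  case True
  let ?f = "\<lambda>_::nat. [Pass c v s, Pass c v (\<not> s)]"
  obtain a a' where h: "h 0 = (a, a')" by fastforce
  let ?G = "\<lambda>_::nat. corner s a (A s a a)"
  have crosses_iff: "(\<forall>k<1. crosses (strand_io star circ g) (?f k) (h k)) \<longleftrightarrow>
     g c s = a \<and> g c (\<not> s) = A s (g c (\<not> s)) a \<and> A (\<not> s) (g c s) (A s (g c (\<not> s)) a) = a'" for g
    using True by (simp add: crosses_def h traverses_Pass actv_def del: traverses.simps(2))
  have labels: "local_labels 1 ?f = {c}"
    using True by (auto simp: local_labels_def)
  have solution: "a = a' \<and> g c = ?G c" if g: "\<forall>k<1. crosses (strand_io star circ g) (?f k) (h k)" for g
  proof -
    \<comment> \<open>The color at the second passage is given only implicitly, in terms of itself;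
      its operator is nevertheless known because it lies in the orbit of \<open>a\<close>.\<close>
    have "A s (g c (\<not> s)) = A s a"
      using g unfolding crosses_iff by (metis act_class)
    note g[unfolded crosses_iff this]
    then show ?thesis by (auto simp: corner_eqI act_cancel)
  qed
  have "local_sum star circ \<phi> 1 ?f h =
    (if a = a' then Poly_Mapping.single (gweight \<phi> (local_labels 1 ?f) ?G) 1 else 0)"
  proof (rule local_sum_unique)
    show "a = a'" if "\<forall>k<1. crosses (strand_io star circ g) (?f k) (h k)" for g
      using solution[OF that] by blast
    show "g l = ?G l" if "\<forall>k<1. crosses (strand_io star circ g) (?f k) (h k)" "l \<in> local_labels 1 ?f" for g l
      using solution[OF that(1)] that(2) unfolding labels by simp
    show "\<forall>k<1. crosses (strand_io star circ ?G) (?f k) (h k)" if "a = a'"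
      unfolding crosses_iff using that by (simp add: act_class act_cancel)
  qed
  moreover have "gweight \<phi> (local_labels 1 ?f) ?G = wt s a (A s a a)"
    unfolding labels by (simp add: gweight_def weight_corner)
  moreover have "wt s a (A s a a) = 0"
  proof (rule no_2_torsion)
    have "wt s a (A s a a) = - wt s a (A s a a)"
      using wt_out[of s "A s a a" a] by (simp only: act_class act_cancel wt_not)
    then show "wt s a (A s a a) + wt s a (A s a a) = 0"
      by (simp only: eq_neg_iff_add_eq_0)
  qed
  moreover have "local_sum star circ \<phi> 1 (\<lambda>_. []) h = (if a = a' then Poly_Mapping.single 0 1 else 0)"
    by (subst local_sum_flat) (simp_all add: local_labels_def h)
  ultimately show ?thesis by (simp only:)
next
  case False
  have "local_labels 1 (\<lambda>_. [Pass c v s, Pass c v (\<not> s)]) = {}" "local_labels 1 (\<lambda>_. []) = {}"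
    using False by (simp_all add: local_labels_def)
  then show ?thesis by (simp add: local_sum_flat)
qed

text \<open>The two forms of \<open>w\<close> are strands running in the same and in opposite
  directions. In both, the colors entering \<open>c2\<close> are those leaving \<open>c1\<close>
  with the sides exchanged, so \<open>wt_out\<close> cancels the weights.\<close>

lemma local_sum_r2:
  assumes "c1 \<noteq> c2" and w: "w = [Pass c1 v (\<not> s), Pass c2 v s] \<or> w = [Pass c2 v s, Pass c1 v (\<not> s)]"
  shows "local_sum star circ \<phi> 2 (\<lambda>k. if k = 0 then [Pass c1 v s, Pass c2 v (\<not> s)] else w) h =
    local_sum star circ \<phi> 2 (\<lambda>_. []) h"
proof (cases v)
  case True
  let ?f = "\<lambda>k::nat. if k = 0 then [Pass c1 v s, Pass c2 v (\<not> s)] else w"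
  have all2: "(\<forall>k<2. P k) \<longleftrightarrow> P 0 \<and> P (Suc 0)" for P
    by (auto simp: numeral_2_eq_2 less_Suc_eq)
  have lt2: "{..<2::nat} = {0, 1}" by auto
  obtain a a' b b' where h: "h 0 = (a, a')" "h (Suc 0) = (b, b')" by fastforce
  have labels: "local_labels 2 ?f = {c1, c2}"
    using w True by (auto simp: local_labels_def lt2)
  \<comment> \<open>The two directions need different inner colorings; afterwards only the vanishing
    of the weight matters.\<close>
  have "\<exists>G. local_sum star circ \<phi> 2 ?f h =
    (if a = a' \<and> b = b' then Poly_Mapping.single (gweight \<phi> (local_labels 2 ?f) G) 1 else 0) \<and>
     gweight \<phi> {c1, c2} G = 0"
    using w
  proof
    assume w: "w = [Pass c1 v (\<not> s), Pass c2 v s]"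
    let ?G = "\<lambda>l. if l = c1 then corner s a b else corner s (A (\<not> s) a b) (A s b a)"
    have crosses_iff: "(\<forall>k<2. crosses (strand_io star circ g) (?f k) (h k)) \<longleftrightarrow>
       g c1 s = a \<and> g c2 (\<not> s) = A s (g c1 (\<not> s)) a \<and> A (\<not> s) (g c2 s) (A s (g c1 (\<not> s)) a) = a' \<and>
       g c1 (\<not> s) = b \<and> g c2 s = A (\<not> s) (g c1 s) b \<and> A s (g c2 (\<not> s)) (A (\<not> s) (g c1 s) b) = b'" for g
      unfolding all2 using True w by (simp add: crosses_def h traverses_Pass actv_def del: traverses.simps(2))
    have solution: "(a = a' \<and> b = b') \<and> g c1 = ?G c1 \<and> g c2 = ?G c2"
      if g: "\<forall>k<2. crosses (strand_io star circ g) (?f k) (h k)" for g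
    proof -
      have *: "g c1 s = a" "g c1 (\<not> s) = b" "g c2 (\<not> s) = A s b a" "g c2 s = A (\<not> s) a b"
        using g unfolding crosses_iff by simp_all
      have "a = a'" "b = b'"
        using g unfolding crosses_iff * by (simp_all add: act_class act_cancel)
      with * show ?thesis using \<open>c1 \<noteq> c2\<close> by (simp add: corner_eqI)
    qed
    have "local_sum star circ \<phi> 2 ?f h =
      (if a = a' \<and> b = b' then Poly_Mapping.single (gweight \<phi> (local_labels 2 ?f) ?G) 1 else 0)"
    proof (rule local_sum_unique)
      show "a = a' \<and> b = b'" if "\<forall>k<2. crosses (strand_io star circ g) (?f k) (h k)" for g
        using solution[OF that] by blast
      show "g l = ?G l" if "\<forall>k<2. crosses (strand_io star circ g) (?f k) (h k)" "l \<in> local_labels 2 ?f" for g l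
        using solution[OF that(1)] that(2) unfolding labels by blast
      show "\<forall>k<2. crosses (strand_io star circ ?G) (?f k) (h k)" if "a = a' \<and> b = b'"
        unfolding crosses_iff using that \<open>c1 \<noteq> c2\<close> by (simp add: act_class act_cancel)
    qed
    moreover have "gweight \<phi> {c1, c2} ?G = 0"
      using \<open>c1 \<noteq> c2\<close> wt_out[of s b a] by (simp add: gweight_def weight_corner wt_not)
    ultimately show ?thesis by blast
  next
    assume w: "w = [Pass c2 v s, Pass c1 v (\<not> s)]"
    \<comment> \<open>The second strand now reaches \<open>c1\<close> last, so it arrives there
      already acted upon by the first strand.\<close>
    let ?G = "\<lambda>l. if l = c1 then corner s a (A s a b) else corner s b (A s b a)"
    have crosses_iff: "(\<forall>k<2. crosses (strand_io star circ g) (?f k) (h k)) \<longleftrightarrow>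
       g c1 s = a \<and> g c2 (\<not> s) = A s (g c1 (\<not> s)) a \<and> A (\<not> s) (g c2 s) (A s (g c1 (\<not> s)) a) = a' \<and>
       g c2 s = b \<and> g c1 (\<not> s) = A s (g c2 (\<not> s)) b \<and> A (\<not> s) (g c1 s) (A s (g c2 (\<not> s)) b) = b'" for g
      unfolding all2 using True w by (simp add: crosses_def h traverses_Pass actv_def del: traverses.simps(2))
    have solution: "(a = a' \<and> b = b') \<and> g c1 = ?G c1 \<and> g c2 = ?G c2"
      if g: "\<forall>k<2. crosses (strand_io star circ g) (?f k) (h k)" for g
    proof -
      have cls: "A s (g c1 (\<not> s)) = A s b" "A s (g c2 (\<not> s)) = A s a"
        using g unfolding crosses_iff by (metis act_class)+
      have *: "g c1 s = a" "g c1 (\<not> s) = A s a b" "g c2 (\<not> s) = A s b a" "g c2 s = b"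
        using g unfolding crosses_iff cls by simp_all
      have "a = a'" "b = b'"
        using g unfolding crosses_iff cls * by (simp_all add: act_class act_cancel)
      with * show ?thesis using \<open>c1 \<noteq> c2\<close> by (simp add: corner_eqI)
    qed
    have "local_sum star circ \<phi> 2 ?f h =
      (if a = a' \<and> b = b' then Poly_Mapping.single (gweight \<phi> (local_labels 2 ?f) ?G) 1 else 0)"
    proof (rule local_sum_unique)
      show "a = a' \<and> b = b'" if "\<forall>k<2. crosses (strand_io star circ g) (?f k) (h k)" for g
        using solution[OF that] by blast
      show "g l = ?G l" if "\<forall>k<2. crosses (strand_io star circ g) (?f k) (h k)" "l \<in> local_labels 2 ?f" for g l
        using solution[OF that(1)] that(2) unfolding labels by blast
      show "\<forall>k<2. crosses (strand_io star circ ?G) (?f k) (h k)" if "a = a' \<and> b = b'"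
        unfolding crosses_iff using that \<open>c1 \<noteq> c2\<close> by (simp add: act_class act_cancel)
    qed
    moreover have "gweight \<phi> {c1, c2} ?G = 0"
      using \<open>c1 \<noteq> c2\<close> wt_out[of s "A s a b" a]
      by (simp add: gweight_def weight_corner wt_not act_class act_cancel)
    ultimately show ?thesis by blast
  qed
  moreover have "local_sum star circ \<phi> 2 (\<lambda>_. []) h = (if a = a' \<and> b = b' then Poly_Mapping.single 0 1 else 0)"
    by (subst local_sum_flat) (simp_all add: local_labels_def h all2)
  ultimately show ?thesis by (auto simp: labels)
next
  case False
  have "local_labels 2 (\<lambda>k. if k = 0 then [Pass c1 v s, Pass c2 v (\<not> s)] else w) = {}"
    "local_labels 2 (\<lambda>_. []) = {}"
    using False w by (auto simp: local_labels_def)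
  then show ?thesis by (simp add: local_sum_flat)
qed

end

section \<open>Independence of labels, base points and order of components\<close>

lemma statesum_relabel:
  fixes star circ :: "'s::finite \<Rightarrow> 's \<Rightarrow> 's" and \<phi> :: "'s \<Rightarrow> 's \<Rightarrow> 'a::comm_monoid_add"
  assumes "inj \<rho>" "wf_diagram D" "wf_diagram (map (map (\<lambda>a. Pass (\<rho> (lbl a)) (virt a) (lft a))) D)"
  shows "statesum star circ \<phi> D = statesum star circ \<phi> (map (map (\<lambda>a. Pass (\<rho> (lbl a)) (virt a) (lft a))) D)"
proof -
  let ?r = "\<lambda>a. Pass (\<rho> (lbl a)) (virt a) (lft a)"
  let ?L = "vlabels (concat D)"
  have L: "vlabels (concat (map (map ?r) D)) = \<rho> ` ?L"
  proof -
    have "vlabels (map ?r w) = \<rho> ` vlabels w" for w by (induction w) auto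
    then show ?thesis unfolding map_concat[symmetric] .
  qed
  have closings: "closings (strand_io star circ g) (map ?r w) = closings (strand_io star circ (\<lambda>c. g (\<rho> c))) w" for g w
    unfolding closings_def traverses_map
    by (intro Collect_cong traverses_cong) (simp add: strand_io_def)
  have restrict: "closings (strand_io star circ (restrict g ?L)) w = closings (strand_io star circ g) w"
    if "w \<in> set D" for g w
  proof -
    have "vlabels w \<subseteq> ?L" using that by (auto simp: vlabels_def)
    then show ?thesis by (simp add: closings_def traverses_strand_io_restrict)
  qed
  have weight: "gweight \<phi> (\<rho> ` ?L) g = gweight \<phi> ?L (\<lambda>c. g (\<rho> c))" for g
    unfolding gweight_def by (subst sum.reindex) (use assms(1) in \<open>auto intro: inj_on_subset\<close>)
  show ?thesis
    unfolding statesum_crossing_colorings[OF assms(2)] statesum_crossing_colorings[OF assms(3)] L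
  proof (rule sum.reindex_bij_witness[symmetric, where i = "\<lambda>g. restrict (\<lambda>c. g (inv \<rho> c)) (\<rho> ` ?L)"
        and j = "\<lambda>g. restrict (\<lambda>c. g (\<rho> c)) ?L"])
    fix g :: "nat \<Rightarrow> bool \<Rightarrow> 's"
    show "Poly_Mapping.single (gweight \<phi> ?L (\<lambda>c\<in>?L. g (\<rho> c)))
        (int (\<Prod>w\<leftarrow>D. card (closings (strand_io star circ (\<lambda>c\<in>?L. g (\<rho> c))) w))) =
      Poly_Mapping.single (gweight \<phi> (\<rho> ` ?L) g)
        (int (\<Prod>w\<leftarrow>map (map ?r) D. card (closings (strand_io star circ g) w)))"
      by (simp add: weight gweight_restrict comp_def closings restrict cong: map_cong)
  qed (use assms(1) in \<open>auto simp: fun_eq_iff PiE_def extensional_def restrict_def\<close>)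
qed

lemma statesum_rotate:
  fixes star circ :: "'s::finite \<Rightarrow> 's \<Rightarrow> 's" and \<phi> :: "'s \<Rightarrow> 's \<Rightarrow> 'a::comm_monoid_add"
  assumes "i < length D" "wf_diagram D" "wf_diagram (D[i := rotate1 (D ! i)])"
  shows "statesum star circ \<phi> D = statesum star circ \<phi> (D[i := rotate1 (D ! i)])"
proof -
  have "map set (D[i := rotate1 (D ! i)]) = map set D"
    using assms(1) by (simp add: map_update list_update_same_conv)
  then have "set (concat (D[i := rotate1 (D ! i)])) = set (concat D)"
    by (metis set_concat set_map)
  then have L: "vlabels (concat (D[i := rotate1 (D ! i)])) = vlabels (concat D)"
    by (simp add: vlabels_def)
  have "map (\<lambda>w. card (closings io w)) (D[i := rotate1 (D ! i)]) = map (\<lambda>w. card (closings io w)) D"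
    for io :: "letter \<Rightarrow> ('s \<times> 's) option"
    using assms(1) by (simp add: map_update card_closings_rotate1 list_update_same_conv)
  then show ?thesis
    unfolding statesum_crossing_colorings[OF assms(2)] statesum_crossing_colorings[OF assms(3)] L by simp
qed

lemma statesum_permute:
  fixes star circ :: "'s::finite \<Rightarrow> 's \<Rightarrow> 's" and \<phi> :: "'s \<Rightarrow> 's \<Rightarrow> 'a::comm_monoid_add"
  assumes "mset D = mset D'" "wf_diagram D" "wf_diagram D'"
  shows "statesum star circ \<phi> D = statesum star circ \<phi> D'"
proof -
  have L: "vlabels (concat D) = vlabels (concat D')"
    using mset_eq_setD[OF assms(1)] by (simp add: vlabels_def)
  have "(\<Prod>w\<leftarrow>D. f w) = (\<Prod>w\<leftarrow>D'. f w)" for f :: "letter list \<Rightarrow> nat"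
    unfolding prod_mset_prod_list[symmetric] using assms(1) by simp
  then show ?thesis
    unfolding statesum_crossing_colorings[OF assms(2)] statesum_crossing_colorings[OF assms(3)] L by simp
qed

section \<open>Invariance under the moves\<close>

lemma (in vflat_cocycle) statesum_flat_step:
  assumes "flat_step D D'"
  shows "statesum star circ \<phi> D = statesum star circ \<phi> D'"
proof -
  have wf: "wf_diagram D" "wf_diagram D'" and "local_move D D'"
    using assms by (auto simp: flat_step_def)
  from this(3) show ?thesis
    using wf
  proof cases
    case (omega1 T c v s)
    show ?thesis
      unfolding omega1(1,2)
    proof (rule statesum_fill_cong[OF wf[unfolded omega1(1,2)] omega1(3)])
      show "local_labels 1 (\<lambda>_. []) \<inter> tlabels T = {}"
        "local_labels 1 (\<lambda>_. [Pass c v s, Pass c v (\<not> s)]) \<inter> tlabels T = {}"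
        using omega1(4) by (auto simp: local_labels_def)
    qed (rule local_sum_r1[symmetric])
  next
    case (omega2 T c1 c2 w2 v s)
    show ?thesis
      unfolding omega2(1,2)
    proof (rule statesum_fill_cong[OF wf[unfolded omega2(1,2)] omega2(3)])
      show "local_labels 2 (\<lambda>_. []) \<inter> tlabels T = {}"
        by (simp add: local_labels_def)
      have "local_labels 2 (\<lambda>k. if k = 0 then [Pass c1 v s, Pass c2 v (\<not> s)] else w2) \<subseteq> {c1, c2}"
        using omega2(7) by (auto simp: local_labels_def split: if_splits)
      then show "local_labels 2 (\<lambda>k. if k = 0 then [Pass c1 v s, Pass c2 v (\<not> s)] else w2) \<inter> tlabels T = {}"
        using omega2(4,5) by blast
    qed (rule local_sum_r2[OF omega2(6,7), symmetric])
  next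
    case (omega3 T x y z vx vy vz p q o2 o3 r o1)
    have D': "D' = fill T (r3words x y z vx vy vz (\<not> o1) (\<not> o2) (\<not> o3) p q r)"
      unfolding omega3(2) r3words_rev ..
    show ?thesis
      unfolding omega3(1) D'
    proof (rule statesum_fill_cong[OF wf[unfolded omega3(1) D'] omega3(3)])
      show "local_sum star circ \<phi> 3 (r3words x y z vx vy vz o1 o2 o3 p q r) h =
        local_sum star circ \<phi> 3 (r3words x y z vx vy vz (\<not> o1) (\<not> o2) (\<not> o3) p q r) h" for h
      proof -
        obtain a a' b b' c c' where h: "h 0 = (a, a')" "h 1 = (b, b')" "h 2 = (c, c')"
          by (meson surj_pair)
        show ?thesis
          \<comment> \<open>The end-color conditions on the two sides coincide literally; only the
            weights have to be compared.\<close>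
          unfolding local_sum_r3[OF omega3(7) h] r3_weight_reverse[OF omega3(8-10)] ..
      qed
      show "local_labels 3 (r3words x y z vx vy vz o1 o2 o3 p q r) \<inter> tlabels T = {}"
        "local_labels 3 (r3words x y z vx vy vz (\<not> o1) (\<not> o2) (\<not> o3) p q r) \<inter> tlabels T = {}"
        unfolding r3_labels using omega3(4-6) by blast+
    qed
  next
    case (relabel \<rho>)
    then show ?thesis using statesum_relabel wf by blast
  next
    case (rotate i)
    then show ?thesis using statesum_rotate wf by blast
  next
    case permute
    then show ?thesis using statesum_permute wf by blast
  qed
qed

theorem theorem5p4:
  fixes star circ :: "'s::finite \<Rightarrow> 's \<Rightarrow> 's"
    and \<phi> :: "'s \<Rightarrow> 's \<Rightarrow> 'a::ab_group_add"
    and D D' :: diagram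
  assumes "vflat_biquandle star circ"
    and "\<forall>x::'a. x + x = 0 \<longrightarrow> x = 0"
    and "\<forall>a b. \<phi> a b + \<phi> (circ b a) (star a b) = 0"
    and "\<forall>a b c. - \<phi> b c + \<phi> (circ b a) (circ c a) + \<phi> (star a b) c - \<phi> a (circ c b)
                 - \<phi> (star a c) (star b c) + \<phi> a b = 0"
    and "\<forall>a b c. - \<phi> b c + \<phi> b (circ c a) + \<phi> a c - \<phi> a (circ c b) = 0"
    and "wf_diagram D"
    and "flat_equiv D D'"
  shows "statesum star circ \<phi> D = statesum star circ \<phi> D'"
proof -
  interpret vflat_cocycle star circ \<phi>
    by standard (use assms in blast)+
  from \<open>flat_equiv D D'\<close> show ?thesis
    unfolding flat_equiv_def
    \<comment> \<open>Equality of state-sums is symmetric, so steps in either direction are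
      covered.\<close>
    by (induction rule: equivclp_induct) (auto dest: statesum_flat_step)
qed

end
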